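(* Let $H$ be a separable real Hilbert space, $|\cdot|$ a measurable norm on $H$, and $B$ the Banach space obtained by completing $H$ with respect to $|\cdot|$. Let $M_p=p+M_0$, where $M_0$ is a closed subspace of $H$ and $p\in M_0^\perp$. Then there is a unique Borel measure $\mu_{M_p}$ on $B$ such that $$\int_B e^{i x^*}\,d\mu_{M_p}=e^{i\langle x^*,p\rangle-\frac12\|x^*_{M_0}\|_{H^*}^2}\quad\text{for all }x^*\in B^*,$$ where $x^*_{M_0}$ denotes the element of $H^*$ given by $x^*|_{M_0}$ on $M_0$ and $0$ on $M_0^\perp$. The measure $\mu_{M_p}$ is concentrated on the closure $\overline{M_p}$ of $M_p$ in $B$.
   Context: A norm $|\cdot|$ on a real separable Hilbert space $H$ is a measurable norm if for every $\epsilon>0$ there is a finite-dimensional subspace $F_0\subset H$ such that $\mathrm{Gauss}[v\in F_1: |v|>\epsilon]<\epsilon$ for every finite-dimensional subspace $F_1\subset H$ orthogonal to $F_0$, where $\mathrm{Gauss}$ is standard Gaussian measure on $F_1$. Elements $x^*\in B^*$ are regarded as elements of $H^*$ by restriction to $H\subset B$. *)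

theory Defs
  imports "HOL-Probability.Probability"
begin

definition separable_sp :: "'a::topological_space itself \<Rightarrow> bool" where
  "separable_sp _ \<longleftrightarrow> (\<exists>D::'a set. countable D \<and> closure D = UNIV)"

definition is_norm_on :: "('a::real_vector \<Rightarrow> real) \<Rightarrow> bool" where
  "is_norm_on N \<longleftrightarrow>
     (\<forall>x. 0 \<le> N x) \<and> (\<forall>x. N x = 0 \<longleftrightarrow> x = 0) \<and>
     (\<forall>c x. N (c *\<^sub>R x) = \<bar>c\<bar> * N x) \<and> (\<forall>x y. N (x + y) \<le> N x + N y)"

definition fin_dim_subspace :: "'a::real_vector set \<Rightarrow> bool" where
  "fin_dim_subspace F \<longleftrightarrow> subspace F \<and> (\<exists>S. finite S \<and> F = span S)"

definition orthonormal_basis_of :: "'a::real_inner set \<Rightarrow> nat \<Rightarrow> (nat \<Rightarrow> 'a) \<Rightarrow> bool" where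
  "orthonormal_basis_of F k e \<longleftrightarrow>
     (\<forall>i<k. \<forall>j<k. inner (e i) (e j) = (if i = j then 1 else 0)) \<and> span (e ` {..<k}) = F"

definition gauss_fin :: "nat \<Rightarrow> (nat \<Rightarrow> 'a::real_inner) \<Rightarrow> 'a set \<Rightarrow> real" where
  "gauss_fin k e A =
     (let P = PiM {..<k} (\<lambda>_. density lborel std_normal_density)
      in measure P {t \<in> space P. (\<Sum>i<k. t i *\<^sub>R e i) \<in> A})"

definition measurable_norm :: "('a::real_inner \<Rightarrow> real) \<Rightarrow> bool" where
  "measurable_norm N \<longleftrightarrow> is_norm_on N \<and>
     (\<forall>\<epsilon>>0. \<exists>F0. fin_dim_subspace F0 \<and>
        (\<forall>F1 k e. fin_dim_subspace F1 \<and> (\<forall>x\<in>F1. \<forall>y\<in>F0. inner x y = 0) \<and>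
                  orthonormal_basis_of F1 k e \<longrightarrow>
                  gauss_fin k e {v\<in>F1. N v > \<epsilon>} < \<epsilon>))"

definition orth_proj :: "'a::real_inner set \<Rightarrow> 'a \<Rightarrow> 'a" where
  "orth_proj M h = (THE m. m \<in> M \<and> (\<forall>y\<in>M. inner (h - m) y = 0))"

definition is_completion_wrt :: "('h::real_normed_vector \<Rightarrow> real) \<Rightarrow> ('h \<Rightarrow> 'b::banach) \<Rightarrow> bool" where
  "is_completion_wrt N j \<longleftrightarrow> linear j \<and> (\<forall>h. norm (j h) = N h) \<and> closure (range j) = UNIV"

end

theory Submission
  imports Defs
begin

text \<open>Uniqueness: by Hahn--Banach the Borel sets of a separable normed space are generated by the
  continuous linear functionals, and Levy's one-dimensional uniqueness theorem propagates through
  finitely many linear constraints one at a time.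

  Existence: the subspaces witnessing measurability of the norm for the tolerances \<open>2\<^sup>-\<^sup>n\<close>, together
  with a dense sequence, are projected to \<open>M\<^sub>0\<close> and orthonormalised there. A vector of \<open>M\<^sub>0\<close> orthogonal
  to the projection of a subspace is orthogonal to the subspace itself, so the blocks of the resulting
  Gaussian series fall under the smallness condition although the witnessing subspaces need not lie
  in \<open>M\<^sub>0\<close>. By Borel--Cantelli the series converges almost surely in \<open>B\<close>, and the law of its sum,
  shifted by \<open>p\<close>, is the required measure.\<close>

section \<open>The Hahn--Banach theorem\<close>

text \<open>The norm \<open>N\<close> is merely a function on the Hilbert space and \<open>j\<close>
  a linear map isometric for \<open>N\<close>; continuity of \<open>j\<close> for the Hilbert norm
  is not given. It has to be extracted from measurability of \<open>N\<close>, by testing on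
  one-dimensional subspaces. Continuity then makes the completion separable and makes every
  functional \<open>xs\<close> of the completion a bounded functional on the Hilbert space. The
  quadratic term of the characteristic functional arises as a limit of variances: the partial sums
  of the series, tested against \<open>xs\<close>, are normal with variance the sum of
  \<open>(xs (j (e i)))^2\<close>, and these sums increase to the squared norm of \<open>xs\<close>
  restricted to the subspace. Separability of the completion is derived inside the proof and is not
  part of its type, so vector-valued measurability is always tested against functionals, by the same
  description of the Borel sets that uniqueness needs. The competing measures are not assumed
  finite; their value at the zero functional makes them probability measures.\<close>

definition sublinear :: "('a::real_vector \<Rightarrow> real) \<Rightarrow> bool" where
  "sublinear q \<longleftrightarrow>
     (\<forall>x y. q (x + y) \<le> q x + q y) \<and> (\<forall>c\<ge>0. \<forall>x. q (c *\<^sub>R x) = c * q x)"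

lemma sublinear_neg_le:
  assumes "sublinear q"
  shows "- q (- x) \<le> q x"
proof -
  have "q (0 *\<^sub>R x) = 0 * q x"
    using assms unfolding sublinear_def by blast
  moreover have "q (x + - x) \<le> q x + q (- x)"
    using assms unfolding sublinear_def by blast
  ultimately show ?thesis by simp
qed

lemma sublinear_norm: "sublinear (norm :: 'a::real_normed_vector \<Rightarrow> real)"
  unfolding sublinear_def by (simp add: norm_triangle_ineq)

text \<open>The auxiliary functional of the Zorn proof of Hahn--Banach. It is at most
  \<open>q\<close> everywhere and at most \<open>- q y\<close> at \<open>- y\<close> (take t = 1),
  so every linear functional below it agrees with \<open>q\<close> at \<open>y\<close>.\<close>

definition sublinear_shift :: "('a::real_vector \<Rightarrow> real) \<Rightarrow> 'a \<Rightarrow> 'a \<Rightarrow> real" where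
  "sublinear_shift q y x = (INF t\<in>{0..}. q (x + t *\<^sub>R y) - t * q y)"

text \<open>Ensures that the real infimum is a genuine one; over a set unbounded below it would
  carry no information.\<close>

lemma sublinear_shift_bdd_below:
  assumes "sublinear q"
  shows "bdd_below ((\<lambda>t. q (x + t *\<^sub>R y) - t * q y) ` {0..})"
proof (rule bdd_belowI2[where m = "- q (- x)"])
  fix t :: real assume "t \<in> {0..}"
  then have "t * q y = q (t *\<^sub>R y)"
    using assms by (simp add: sublinear_def)
  also have "t *\<^sub>R y = (x + t *\<^sub>R y) + - x" by simp
  also have "q \<dots> \<le> q (x + t *\<^sub>R y) + q (- x)"
    using assms unfolding sublinear_def by blast
  finally show "- q (- x) \<le> q (x + t *\<^sub>R y) - t * q y" by linarith
qed

lemma sublinear_shift_le: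
  assumes "sublinear q" "t \<ge> 0"
  shows "sublinear_shift q y x \<le> q (x + t *\<^sub>R y) - t * q y"
  unfolding sublinear_shift_def
  by (rule cINF_lower[OF sublinear_shift_bdd_below]) (use assms in auto)

lemma sublinear_shift_greatest:
  assumes "\<And>t. t \<ge> 0 \<Longrightarrow> a \<le> q (x + t *\<^sub>R y) - t * q y"
  shows "a \<le> sublinear_shift q y x"
  unfolding sublinear_shift_def by (rule cINF_greatest) (use assms in auto)

text \<open>Parameters \<open>s\<close> for \<open>u\<close> and \<open>t\<close> for
  \<open>v\<close> combine to the admissible parameter \<open>s + t\<close> for
  \<open>u + v\<close>; scaling by \<open>c\<close> turns the parameter \<open>t\<close> into
  \<open>t / c\<close>.\<close>

lemma sublinear_sublinear_shift:
  assumes q: "sublinear q"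
  shows "sublinear (sublinear_shift q y)"
proof -
  let ?s = "sublinear_shift q y"
  have add: "?s (u + v) \<le> ?s u + ?s v" for u v
  proof -
    have *: "?s (u + v) - (q (v + t *\<^sub>R y) - t * q y) \<le> ?s u" if "t \<ge> 0" for t
    proof (rule sublinear_shift_greatest)
      fix s :: real assume "s \<ge> 0"
      have "?s (u + v) \<le> q (u + v + (s + t) *\<^sub>R y) - (s + t) * q y"
        using \<open>s \<ge> 0\<close> that by (intro sublinear_shift_le q) auto
      also have "u + v + (s + t) *\<^sub>R y = (u + s *\<^sub>R y) + (v + t *\<^sub>R y)"
        by (simp add: algebra_simps)
      also have "q \<dots> \<le> q (u + s *\<^sub>R y) + q (v + t *\<^sub>R y)"
        using q unfolding sublinear_def by blast
      finally show "?s (u + v) - (q (v + t *\<^sub>R y) - t * q y) \<le> q (u + s *\<^sub>R y) - s * q y"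
        by (simp add: algebra_simps)
    qed
    have "?s (u + v) - ?s u \<le> ?s v"
      by (rule sublinear_shift_greatest) (use * in \<open>smt (verit)\<close>)
    then show ?thesis by linarith
  qed
  have le: "c * ?s x \<le> ?s (c *\<^sub>R x)" if "c > 0" for c x
  proof (rule sublinear_shift_greatest)
    fix t :: real assume "t \<ge> 0"
    have "?s x \<le> q (x + (t / c) *\<^sub>R y) - (t / c) * q y"
      using that \<open>t \<ge> 0\<close> by (intro sublinear_shift_le q) auto
    then have "c * ?s x \<le> c * (q (x + (t / c) *\<^sub>R y) - (t / c) * q y)"
      using that by (simp add: mult_left_mono)
    also have "\<dots> = c * q (x + (t / c) *\<^sub>R y) - t * q y"
      using that by (simp add: right_diff_distrib)
    also have "c * q (x + (t / c) *\<^sub>R y) = q (c *\<^sub>R (x + (t / c) *\<^sub>R y))"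
      using q that by (simp add: sublinear_def)
    also have "c *\<^sub>R (x + (t / c) *\<^sub>R y) = c *\<^sub>R x + t *\<^sub>R y"
      using that by (simp add: scaleR_add_right)
    finally show "c * ?s x \<le> q (c *\<^sub>R x + t *\<^sub>R y) - t * q y" .
  qed
  \<comment> \<open>The reverse inequality is the previous one for the factor \<open>1 / c\<close>
    at the point \<open>c *\<^sub>R x\<close>.\<close>
  have ge: "?s (c *\<^sub>R x) \<le> c * ?s x" if "c > 0" for c x
    using le[of "1 / c" "c *\<^sub>R x"] that by (simp add: field_simps)
  have q0: "q 0 = 0"
    using q[unfolded sublinear_def, THEN conjunct2, rule_format, of 0 0] by simp
  have "?s 0 = 0"
  proof (rule antisym)
    show "?s 0 \<le> 0" using sublinear_shift_le[OF q, of 0 y 0] q0 by simp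
    show "0 \<le> ?s 0"
      by (rule sublinear_shift_greatest) (use q in \<open>simp add: sublinear_def\<close>)
  qed
  then have "?s (c *\<^sub>R x) = c * ?s x" if "c \<ge> 0" for c x
    using le[of c x] ge[of c x] that by (cases "c = 0") auto
  then show ?thesis
    using add unfolding sublinear_def by blast
qed

text \<open>The shift of \<open>q\<close> along any \<open>y\<close> is sublinear and below
  \<open>q\<close>, hence equal to \<open>q\<close>; its defining bound at t = 1 then reads
  \<open>q x + q y \<le> q (x + y)\<close>, the missing half of additivity.\<close>

lemma minimal_sublinear_is_linear:
  assumes q: "sublinear q"
    and min: "\<And>r. sublinear r \<Longrightarrow> r \<le> q \<Longrightarrow> r = q"
  shows "linear q"
proof -
  have "sublinear_shift q y = q" for y
  proof (rule min)
    show "sublinear_shift q y \<le> q"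
      using sublinear_shift_le[OF q, of 0 y] by (simp add: le_fun_def)
  qed (rule sublinear_sublinear_shift[OF q])
  then have "q x + q y \<le> q (x + y)" for x y
    using sublinear_shift_le[OF q, of 1 y x] by simp
  then have add: "q (x + y) = q x + q y" for x y
    using q unfolding sublinear_def by (intro antisym) auto
  have pos: "q (c *\<^sub>R x) = c * q x" if "c \<ge> 0" for c x
    using q that unfolding sublinear_def by blast
  have neg: "q (- x) = - q x" for x
    using add[of x "- x"] pos[of 0 0] by simp
  have "q (c *\<^sub>R x) = c * q x" for c x
    using pos[of c x] pos[of "- c" x] neg[of "c *\<^sub>R x"] by (cases "c \<ge> 0") auto
  with add show ?thesis by (intro linearI) auto
qed

text \<open>Zorn's lemma is applied to the reversed pointwise order, so that its maximal elements
  are minimal functionals. A chain is bounded by its pointwise infimum, which is finite because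
  every member stays above \<open>- p (- x)\<close>.\<close>

lemma exists_linear_le_sublinear:
  assumes p: "sublinear p"
  shows "\<exists>f. linear f \<and> (\<forall>x. f x \<le> p x)"
proof -
  define A where "A = {q. sublinear q \<and> q \<le> p}"
  have "\<exists>m\<in>A. \<forall>a\<in>A. m \<ge> a \<longrightarrow> a = m"
  proof (rule predicate_Zorn)
    show "partial_order_on A (relation_of (\<ge>) A)"
      by (rule partial_order_on_relation_ofI) auto
    fix C assume C: "C \<in> Chains (relation_of (\<ge>) A)"
    then have CA: "C \<subseteq> A" and chain: "\<And>a b. a \<in> C \<Longrightarrow> b \<in> C \<Longrightarrow> a \<le> b \<or> b \<le> a"
      unfolding Chains_def relation_of_def by auto
    show "\<exists>u\<in>A. \<forall>a\<in>C. u \<le> a"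
    proof (cases "C = {}")
      case True
      then show ?thesis using p by (auto simp: A_def)
    next
      case False
      define u where "u x = (INF q\<in>C. q x)" for x
      have bdd: "bdd_below ((\<lambda>q. q x) ` C)" for x
      proof (rule bdd_belowI2[where m = "- p (- x)"])
        fix q assume "q \<in> C"
        then have "sublinear q" "q (- x) \<le> p (- x)" using CA by (auto simp: A_def le_fun_def)
        then show "- p (- x) \<le> q x" using sublinear_neg_le[of q x] by linarith
      qed
      have low: "u x \<le> q x" if "q \<in> C" for q x
        unfolding u_def by (rule cINF_lower[OF bdd that])
      have great: "a \<le> u x" if "\<And>q. q \<in> C \<Longrightarrow> a \<le> q x" for a x
        unfolding u_def using that False by (intro cINF_greatest) auto
      have sub: "sublinear q" if "q \<in> C" for q using that CA by (auto simp: A_def)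
      have add: "u (x + y) \<le> u x + u y" for x y
      proof -
        \<comment> \<open>The two members are comparable; subadditivity of the smaller one bounds
          both cases.\<close>
        have *: "u (x + y) \<le> q x + r y" if "q \<in> C" "r \<in> C" for q r
        proof -
          have "u (x + y) \<le> s x + s y" if "s \<in> C" for s
            using low[OF that, of "x + y"] sub[OF that] unfolding sublinear_def
            by (meson order_trans)
          from this[OF \<open>q \<in> C\<close>] this[OF \<open>r \<in> C\<close>] show ?thesis
            using chain[OF that] by (auto simp: le_fun_def) (smt (verit))+
        qed
        have "u (x + y) - r y \<le> u x" if "r \<in> C" for r
          by (rule great) (use *[OF _ that] in \<open>simp add: algebra_simps\<close>)
        then have "u (x + y) - u x \<le> u y"
          by (intro great) (simp add: algebra_simps)
        then show ?thesis by linarith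
      qed
      have hom: "u (c *\<^sub>R x) = c * u x" if "c \<ge> 0" for c x
      proof -
        have eq: "q (d *\<^sub>R z) = d * q z" if "q \<in> C" "d \<ge> 0" for q z d
          using sub that unfolding sublinear_def by blast
        have le: "d * u z \<le> u (d *\<^sub>R z)" if "d \<ge> 0" for d z
          by (rule great) (use that low in \<open>simp add: eq mult_left_mono\<close>)
        show ?thesis
        proof (cases "c = 0")
          case True
          have "u (0 *\<^sub>R x) = (INF q\<in>C. 0)"
            unfolding u_def by (rule INF_cong) (use eq[of _ 0] in auto)
          then show ?thesis using True False by simp
        next
          case F: False
          have "(1 / c) * u (c *\<^sub>R x) \<le> u x"
            using le[of "1 / c" "c *\<^sub>R x"] that F by simp
          then have "u (c *\<^sub>R x) \<le> c * u x" using that F by (simp add: field_simps)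
          with le[OF that] show ?thesis by (intro antisym) auto
        qed
      qed
      have "sublinear u" using add hom by (simp add: sublinear_def)
      moreover have "u \<le> p"
      proof -
        obtain q where "q \<in> C" using False by blast
        with CA low[of q] show ?thesis by (force simp: A_def le_fun_def intro: order_trans)
      qed
      ultimately show ?thesis
        using low by (intro bexI[of _ u]) (auto simp: A_def le_fun_def)
    qed
  qed
  then obtain q where q: "sublinear q" "q \<le> p" and min: "\<And>r. r \<in> A \<Longrightarrow> r \<le> q \<Longrightarrow> r = q"
    by (auto simp: A_def)
  have "linear q"
    by (rule minimal_sublinear_is_linear[OF q(1)], rule min) (use q in \<open>auto simp: A_def\<close>)
  with q show ?thesis by (auto simp: le_fun_def)
qed

text \<open>Dominating the functional by the shift of the norm along the given vector, instead of by the
  norm itself, forces it to attain the norm at that vector.\<close>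

lemma exists_norming_functional:
  fixes x0 :: "'a::real_normed_vector"
  shows "\<exists>f. linear f \<and> (\<forall>x. \<bar>f x\<bar> \<le> norm x) \<and> f x0 = norm x0"
proof -
  let ?q = "sublinear_shift norm x0"
  obtain f where f: "linear f" "\<And>x. f x \<le> ?q x"
    using exists_linear_le_sublinear[OF sublinear_sublinear_shift[OF sublinear_norm]] by blast
  have le: "f x \<le> norm x" for x
    using f(2)[of x] sublinear_shift_le[OF sublinear_norm, of 0 x0 x] by simp
  have neg: "f (- x) = - f x" for x
    using f(1) by (simp add: linear_neg)
  have "f (- x0) \<le> norm (- x0 + 1 *\<^sub>R x0) - 1 * norm x0"
    using f(2)[of "- x0"] sublinear_shift_le[OF sublinear_norm, of 1 x0 "- x0"] by linarith
  then have "norm x0 \<le> f x0" by (simp add: neg)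
  moreover have "\<bar>f x\<bar> \<le> norm x" for x
    using le[of x] le[of "- x"] neg[of x] by (simp add: abs_le_iff)
  ultimately show ?thesis using f(1) le[of x0] by (intro exI[of _ f]) auto
qed

section \<open>Uniqueness of characteristic functionals\<close>

text \<open>These are finite intersections of preimages of real Borel sets under functionals.
  Building them one functional at a time supplies the induction along which equality of measures is
  propagated.\<close>

inductive_set cylinder_sets :: "'b::real_normed_vector set set" where
  UNIV: "UNIV \<in> cylinder_sets"
| Int_vimage: "C \<in> cylinder_sets \<Longrightarrow> bounded_linear f \<Longrightarrow> A \<in> sets (borel :: real measure)
    \<Longrightarrow> C \<inter> f -` A \<in> cylinder_sets"

lemma Int_stable_cylinder_sets: "Int_stable (cylinder_sets :: 'b::real_normed_vector set set)"
proof (rule Int_stableI)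
  fix B C :: "'b set"
  assume "C \<in> cylinder_sets" "B \<in> cylinder_sets"
  then show "B \<inter> C \<in> cylinder_sets"
  proof induction
    case (Int_vimage C f A)
    have "B \<inter> (C \<inter> f -` A) = (B \<inter> C) \<inter> f -` A" by blast
    then show ?case using Int_vimage by (simp add: cylinder_sets.Int_vimage)
  qed simp
qed

section \<open>The Borel sets of a separable normed space\<close>

lemma bounded_linear_borel_measurable:
  fixes f :: "'a::real_normed_vector \<Rightarrow> 'b::real_normed_vector"
  assumes "bounded_linear f"
  shows "f \<in> borel_measurable borel"
  by (rule borel_measurable_continuous_onI) (simp add: assms linear_continuous_on)

lemma cylinder_sets_in_borel:
  fixes C :: "'b::real_normed_vector set"
  shows "C \<in> cylinder_sets \<Longrightarrow> C \<in> sets borel"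
proof (induction rule: cylinder_sets.induct)
  case (Int_vimage C f A)
  then show ?case
    using measurable_sets[OF bounded_linear_borel_measurable[of f], of A] by auto
qed auto

text \<open>Countably many half-spaces suffice because the functional that norms \<open>d\<close>
  almost norms every vector close to \<open>d\<close>, and \<open>x - c\<close> is a limit of such
  \<open>d\<close>.\<close>

lemma cball_eq_INT_norming:
  fixes D :: "'b::real_normed_vector set" and f :: "'b \<Rightarrow> 'b \<Rightarrow> real"
  assumes D: "closure D = UNIV"
    and lin: "\<And>d. linear (f d)" and le: "\<And>d x. \<bar>f d x\<bar> \<le> norm x" and eq: "\<And>d. f d d = norm d"
  shows "cball c r = (\<Inter>d\<in>D. f d -` {..r + f d c})"
proof (intro set_eqI iffI)
  fix x assume "x \<in> cball c r"
  then have "f d (x - c) \<le> r" for d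
    using le[of d "x - c"] by (simp add: dist_norm norm_minus_commute)
  then show "x \<in> (\<Inter>d\<in>D. f d -` {..r + f d c})"
    using lin by (auto simp: linear_diff algebra_simps)
next
  fix x assume x: "x \<in> (\<Inter>d\<in>D. f d -` {..r + f d c})"
  have "norm (x - c) \<le> r + e" if "e > 0" for e
  \<comment> \<open>With \<open>d\<close> within \<open>e / 2\<close> of \<open>x - c\<close>, the
    value of \<open>f d\<close> at \<open>x - c\<close> and the norm of \<open>x - c\<close> both
    differ from \<open>norm d\<close> by less than \<open>e / 2\<close>.\<close>
  proof -
    have "x - c \<in> closure D" using D by simp
    then obtain d where d: "d \<in> D" "dist d (x - c) < e / 2"
      using \<open>e > 0\<close> unfolding closure_approachable by (meson half_gt_zero)
    let ?z = "x - c - d"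
    have z: "norm ?z < e / 2" using d(2) by (simp add: dist_norm norm_minus_commute)
    have "f d (x - c) \<le> r" using x d(1) lin by (auto simp: linear_diff algebra_simps)
    moreover have "f d (x - c) = norm d + f d ?z"
      using lin eq by (simp add: linear_diff)
    moreover have "- norm ?z \<le> f d ?z" using le[of d ?z] by linarith
    moreover have "norm (x - c) \<le> norm d + norm ?z"
      using norm_triangle_ineq[of d ?z] by simp
    ultimately show ?thesis using z by linarith
  qed
  then show "x \<in> cball c r"
    by (auto simp: dist_norm norm_minus_commute intro: field_le_epsilon)
qed

lemma sets_borel_eq_cylinder_sets:
  fixes D :: "'b::real_normed_vector set"
  assumes D: "countable D" "closure D = UNIV"
  shows "sets (borel :: 'b measure) = sigma_sets UNIV cylinder_sets"
proof
  show "sigma_sets UNIV cylinder_sets \<subseteq> sets (borel :: 'b measure)"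
    using cylinder_sets_in_borel sets.sigma_sets_subset[of cylinder_sets "borel :: 'b measure"]
    by auto
  have "\<forall>d::'b. \<exists>f. linear f \<and> (\<forall>x. \<bar>f x\<bar> \<le> norm x) \<and> f d = norm d"
    using exists_norming_functional by blast
  then obtain f where "\<forall>d::'b. linear (f d) \<and> (\<forall>x. \<bar>f d x\<bar> \<le> norm x) \<and> f d d = norm d"
    by (rule choice[THEN exE])
  then have f: "\<And>d::'b. linear (f d)" "\<And>d x. \<bar>f d x\<bar> \<le> norm x" "\<And>d. f d d = norm d" by auto
  have bl: "bounded_linear (f d)" for d
    by (rule bounded_linear_intro[where K = 1]) (use f in \<open>auto simp: linear_add linear_scale\<close>)
  interpret sigma_algebra UNIV "sigma_sets UNIV cylinder_sets :: 'b set set"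
    by (rule sigma_algebra_sigma_sets) simp
  have "D \<noteq> {}" using D(2) by auto
  have cball: "cball c r \<in> sigma_sets UNIV cylinder_sets" for c :: 'b and r
    unfolding cball_eq_INT_norming[OF D(2) f]
  proof (rule countable_INT'[OF D(1) \<open>D \<noteq> {}\<close>], safe)
    fix d
    have "UNIV \<inter> f d -` {..r + f d c} \<in> cylinder_sets"
      by (intro cylinder_sets.intros bl) auto
    then show "f d -` {..r + f d c} \<in> sigma_sets UNIV cylinder_sets"
      by (intro sigma_sets.Basic) simp
  qed
  have "U \<in> sigma_sets UNIV cylinder_sets" if "open U" for U :: "'b set"
  proof -
    let ?I = "{(c, r). c \<in> D \<and> r \<in> \<rat> \<and> cball c r \<subseteq> U}"
    have "U \<subseteq> (\<Union>(c, r)\<in>?I. cball c r)"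
    proof
      fix x assume "x \<in> U"
      then obtain e where e: "e > 0" "ball x e \<subseteq> U" using \<open>open U\<close> open_contains_ball by blast
      \<comment> \<open>A centre within \<open>e / 4\<close> of \<open>x\<close> gives a ball that
        contains \<open>x\<close> since the radius exceeds \<open>e / 4\<close>, and that stays in
        \<open>ball x e\<close> since \<open>e / 4 + e / 2 < e\<close>.\<close>
      obtain r where r: "r \<in> \<rat>" "e / 4 < r" "r < e / 2"
        using Rats_dense_in_real[of "e / 4" "e / 2"] e by auto
      have "x \<in> closure D" using D(2) by simp
      then obtain c where c: "c \<in> D" "dist c x < e / 4"
        using e(1) unfolding closure_approachable by (meson divide_pos_pos zero_less_numeral)
      have "cball c r \<subseteq> ball x e"
      proof
        fix y assume "y \<in> cball c r"
        then show "y \<in> ball x e"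
          using dist_triangle[of x y c] c r by (simp add: dist_commute)
      qed
      moreover have "x \<in> cball c r" using c r by simp
      ultimately show "x \<in> (\<Union>(c, r)\<in>?I. cball c r)"
        using c r e by (intro UN_I[of "(c, r)"]) auto
    qed
    then have "U = (\<Union>(c, r)\<in>?I. cball c r)" by auto
    moreover have "countable ?I"
      by (rule countable_subset[OF _ countable_SIGMA[OF D(1) countable_rat[where 'a = real]]])
        auto
    then have "(\<Union>(c, r)\<in>?I. cball c r) \<in> sigma_sets UNIV cylinder_sets"
      by (rule countable_UN') (use cball in auto)
    ultimately show ?thesis by simp
  qed
  then show "sets (borel :: 'b measure) \<subseteq> sigma_sets UNIV cylinder_sets"
    unfolding borel_def by (subst sets_measure_of) (auto intro!: sigma_sets_subset)
qed

text \<open>Reduces measurability of vector-valued sums and limits to real-valued functions, with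
  separability of the codomain supplied by \<open>D\<close>.\<close>

lemma borel_measurable_if_functionals:
  fixes f :: "'a \<Rightarrow> 'b::real_normed_vector"
  assumes D: "countable (D :: 'b set)" "closure D = UNIV"
    and f: "\<And>g :: 'b \<Rightarrow> real. bounded_linear g \<Longrightarrow> (\<lambda>x. g (f x)) \<in> borel_measurable M"
  shows "f \<in> borel_measurable M"
proof (rule measurable_sigma_sets[OF sets_borel_eq_cylinder_sets[OF D]])
  fix C :: "'b set" assume "C \<in> cylinder_sets"
  then show "f -` C \<inter> space M \<in> sets M"
  proof induction
    case (Int_vimage C g A)
    have "f -` (C \<inter> g -` A) \<inter> space M =
        (f -` C \<inter> space M) \<inter> ((\<lambda>x. g (f x)) -` A \<inter> space M)" by auto
    then show ?case
      using sets.Int[OF Int_vimage.IH measurable_sets[OF f[OF Int_vimage.hyps(2)] Int_vimage.hyps(3)]]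
      by (simp only:)
  qed auto
qed auto

text \<open>Taking t = 0 shows that the weight has the same total mass \<open>c\<close> under both
  measures. If \<open>c > 0\<close>, dividing the weight by \<open>c\<close> gives probability
  densities, and Levy's theorem applies to the laws of \<open>y\<close> under them; if
  \<open>c = 0\<close>, the weight vanishes almost everywhere and both sides are zero.\<close>

lemma integral_weighted_vimage_eq_if_char_eq:
  fixes w y :: "'a \<Rightarrow> real"
  assumes "finite_measure M" "finite_measure N" and [measurable_cong]: "sets M = sets N"
    and [measurable]: "w \<in> borel_measurable M" "y \<in> borel_measurable M"
    and w: "\<And>x. 0 \<le> w x" "\<And>x. w x \<le> K"
    and char: "\<And>t. (LINT x|M. w x *\<^sub>R cis (t * y x)) = (LINT x|N. w x *\<^sub>R cis (t * y x))"
    and A[measurable]: "A \<in> sets borel"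
  shows "(LINT x|M. w x * indicator A (y x)) = (LINT x|N. w x * indicator A (y x))"
proof -
  interpret M: finite_measure M by fact
  interpret N: finite_measure N by fact
  define c where "c = (LINT x|M. w x)"
  have int: "integrable M w" "integrable N w"
    using w by (auto intro!: M.integrable_const_bound[where B = K] N.integrable_const_bound[where B = K]
      simp: abs_le_iff)
  have "complex_of_real (LINT x|M. w x) = complex_of_real (LINT x|N. w x)"
    using char[of 0] int by (simp add: scaleR_conv_of_real)
  then have cN: "c = (LINT x|N. w x)" by (simp add: c_def)
  show ?thesis
  proof (cases "c = 0")
    case True
    have "AE x in M. w x = 0"
      using True int w by (subst (asm) c_def, subst (asm) integral_nonneg_eq_0_iff_AE) auto
    moreover have "AE x in N. w x = 0"
      using True int w by (subst (asm) cN, subst (asm) integral_nonneg_eq_0_iff_AE) auto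
    ultimately have "(LINT x|M. w x * indicator A (y x)) = 0" "(LINT x|N. w x * indicator A (y x)) = 0"
      by (auto intro!: integral_eq_zero_AE)
    then show ?thesis by simp
  next
    case False
    have "c \<ge> 0" unfolding c_def using w by simp
    with False have c: "c > 0" by simp
    have law: "real_distribution (distr (density L (\<lambda>x. w x / c)) borel y) \<and>
        (\<forall>t. char (distr (density L (\<lambda>x. w x / c)) borel y) t
          = (1 / c) *\<^sub>R (LINT x|L. w x *\<^sub>R cis (t * y x))) \<and>
        measure (distr (density L (\<lambda>x. w x / c)) borel y) A
          = (1 / c) * (LINT x|L. w x * indicator A (y x))"
      if L: "finite_measure L" "integrable L w" "(LINT x|L. w x) = c" "sets L = sets N"
      for L
    proof -
      interpret L: finite_measure L by fact
      note [measurable_cong] = L(4)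
      have "emeasure (density L (\<lambda>x. w x / c)) (space L) = (\<integral>\<^sup>+x. ennreal (w x / c) \<partial>L)"
        by (subst emeasure_density) (auto intro!: nn_integral_cong)
      also have "\<dots> = ennreal (LINT x|L. w x / c)"
        using L w c by (intro nn_integral_eq_integral) auto
      also have "\<dots> = 1" using L(3) c by simp
      finally have P: "prob_space (density L (\<lambda>x. w x / c))"
        by (intro prob_spaceI) simp
      then interpret P: prob_space "density L (\<lambda>x. w x / c)" .
      have 1: "real_distribution (distr (density L (\<lambda>x. w x / c)) borel y)"
        by (rule P.real_distribution_distr) simp
      have 2: "char (distr (density L (\<lambda>x. w x / c)) borel y) t
          = (1 / c) *\<^sub>R (LINT x|L. w x *\<^sub>R cis (t * y x))" for t
      proof -
        have "char (distr (density L (\<lambda>x. w x / c)) borel y) t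
            = (LINT x|density L (\<lambda>x. w x / c). cis (t * y x))"
          unfolding char_def by (subst integral_distr) (simp_all add: cis_conv_exp)
        also have "\<dots> = (LINT x|L. (w x / c) *\<^sub>R cis (t * y x))"
          using w c by (intro integral_density) (auto simp: cis_conv_exp)
        also have "\<dots> = (LINT x|L. (1 / c) *\<^sub>R (w x *\<^sub>R cis (t * y x)))" by simp
        also have "\<dots> = (1 / c) *\<^sub>R (LINT x|L. w x *\<^sub>R cis (t * y x))"
          by (rule integral_scaleR_right)
        finally show ?thesis .
      qed
      have "measure (distr (density L (\<lambda>x. w x / c)) borel y) A
          = (LINT z|distr (density L (\<lambda>x. w x / c)) borel y. indicator A z)"
        by simp
      also have "\<dots> = (LINT x|density L (\<lambda>x. w x / c). indicator A (y x))"
        by (subst integral_distr) simp_all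
      also have "\<dots> = (LINT x|L. (w x / c) *\<^sub>R indicator A (y x))"
        using w c by (intro integral_density) auto
      also have "\<dots> = (LINT x|L. (1 / c) *\<^sub>R (w x * indicator A (y x)))" by simp
      also have "\<dots> = (1 / c) *\<^sub>R (LINT x|L. w x * indicator A (y x))"
        by (rule integral_scaleR_right)
      finally show ?thesis using 1 2 by simp
    qed
    note lM = law[OF \<open>finite_measure M\<close> int(1) c_def[symmetric] \<open>sets M = sets N\<close>]
    note lN = law[OF \<open>finite_measure N\<close> int(2) cN[symmetric] refl]
    have "distr (density M (\<lambda>x. w x / c)) borel y = distr (density N (\<lambda>x. w x / c)) borel y"
      using lM lN char by (intro Levy_uniqueness) auto
    then show ?thesis using lM lN c by simp
  qed
qed

text \<open>Product-to-sum formula: a trigonometric weight times a character is a combination of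
  characters, so integrals with such weights are determined by the characteristic
  functional.\<close>

lemma one_plus_cos_scaleR_cis:
  "(1 + cos a) *\<^sub>R cis b = cis b + 1/2 * cis (a + b) + 1/2 * cis (b - a)"
  by (simp add: complex_eq_iff cos_add cos_diff sin_add sin_diff add_divide_distrib diff_divide_distrib algebra_simps)

lemma one_plus_sin_scaleR_cis:
  "(1 + sin a) *\<^sub>R cis b = cis b + (- \<i> / 2) * cis (a + b) + (\<i> / 2) * cis (b - a)"
  by (simp add: complex_eq_iff cos_add cos_diff sin_add sin_diff add_divide_distrib diff_divide_distrib algebra_simps)

text \<open>A multidimensional uniqueness theorem is avoided by adding one linear constraint at a time:
  the signed weights cos and sin become nonnegative after adding 1, so that the one-dimensional
  uniqueness theorem applies to the weighted laws of a single functional.\<close>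

lemma integral_cylinder_cis_eq:
  fixes \<mu> \<nu> :: "'b::real_normed_vector measure"
  assumes "finite_measure \<mu>" "finite_measure \<nu>"
    and [measurable_cong, simp]: "sets \<mu> = sets borel" "sets \<nu> = sets borel"
    and char: "\<And>f. bounded_linear f \<Longrightarrow> (LINT x|\<mu>. cis (f x)) = (LINT x|\<nu>. cis (f x))"
    and C: "C \<in> cylinder_sets" and f: "bounded_linear f"
  shows "(LINT x|\<mu>. indicator C x *\<^sub>R cis (f x)) = (LINT x|\<nu>. indicator C x *\<^sub>R cis (f x))"
  using C f
proof (induction arbitrary: f)
  case UNIV
  then show ?case using char by simp
next
  case (Int_vimage C y A)
  interpret \<mu>: finite_measure \<mu> by fact
  interpret \<nu>: finite_measure \<nu> by fact
  note f = \<open>bounded_linear f\<close> and y = \<open>bounded_linear y\<close>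
  have [measurable]: "C \<in> sets borel" using Int_vimage by (simp add: cylinder_sets_in_borel)
  have [measurable]: "A \<in> sets borel" by fact
  have bm [measurable]: "f \<in> borel_measurable borel" "y \<in> borel_measurable borel"
    using f y by (simp_all add: bounded_linear_borel_measurable)
  have cis_meas [measurable]: "(\<lambda>x. cis (g x)) \<in> borel_measurable L"
    if [measurable]: "g \<in> borel_measurable L" for g :: "'b \<Rightarrow> real" and L
    by (simp add: cis_conv_exp)
  have int: "integrable \<mu> g" "integrable \<nu> g"
    if "g \<in> borel_measurable borel" "\<And>x. norm (g x) \<le> 2"
    for g :: "'b \<Rightarrow> 'c::{banach, second_countable_topology}"
    using that by (auto intro!: \<mu>.integrable_const_bound[where B = 2] \<nu>.integrable_const_bound[where B = 2]
      simp: measurable_cong_sets[of \<mu> borel] measurable_cong_sets[of \<nu> borel])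
  have sum: "bounded_linear (\<lambda>x. f x + t * y x)" "bounded_linear (\<lambda>x. t * y x - f x)"
    "bounded_linear (\<lambda>x. t * y x)" for t
    using f y by (auto intro!: bounded_linear_add bounded_linear_sub bounded_linear_const_mult)
  define G where "G g x = indicator C x *\<^sub>R cis (g x)" for g :: "'b \<Rightarrow> real" and x
  have intG: "integrable \<mu> (G g)" "integrable \<nu> (G g)" if "bounded_linear g" for g
  proof -
    note [measurable] = bounded_linear_borel_measurable[OF that]
    have "G g \<in> borel_measurable borel" unfolding G_def by measurable
    then show "integrable \<mu> (G g)" "integrable \<nu> (G g)"
      by (auto intro!: int simp: G_def split: split_indicator)
  qed
  have IH: "integral\<^sup>L \<mu> (G g) = integral\<^sup>L \<nu> (G g)" if "bounded_linear g" for g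
    unfolding G_def by (rule Int_vimage.IH[OF that])
  \<comment> \<open>The induction hypothesis is needed at \<open>t * y\<close> and at its sum and
    difference with \<open>f\<close>, which is why \<open>f\<close> is kept arbitrary in the
    induction.\<close>
  have comb: "(LINT x|\<mu>. G (\<lambda>x. t * y x) x + a * G (\<lambda>x. f x + t * y x) x + b * G (\<lambda>x. t * y x - f x) x)
      = (LINT x|\<nu>. G (\<lambda>x. t * y x) x + a * G (\<lambda>x. f x + t * y x) x + b * G (\<lambda>x. t * y x - f x) x)"
    for a b t
    using intG[OF sum(1)] intG[OF sum(2)] intG[OF sum(3)]
      IH[OF sum(1)] IH[OF sum(2)] IH[OF sum(3)] by simp
  have w0: "(LINT x|\<mu>. indicator C x *\<^sub>R cis (t * y x)) = (LINT x|\<nu>. indicator C x *\<^sub>R cis (t * y x))" for t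
    by (rule Int_vimage.IH) (rule sum)
  have "(indicator C x * (1 + cos (f x))) *\<^sub>R cis (t * y x)
      = G (\<lambda>x. t * y x) x + 1/2 * G (\<lambda>x. f x + t * y x) x + 1/2 * G (\<lambda>x. t * y x - f x) x" for x t
    using one_plus_cos_scaleR_cis[of "f x" "t * y x"] 
    by (cases "x \<in> C") (simp_all only: G_def indicator_simps not_False_eq_True mult_1 mult_zero_left mult_zero_right scaleR_zero_left scaleR_one add_0)
  then have w1: "(LINT x|\<mu>. (indicator C x * (1 + cos (f x))) *\<^sub>R cis (t * y x))
      = (LINT x|\<nu>. (indicator C x * (1 + cos (f x))) *\<^sub>R cis (t * y x))" for t
    using comb[of t "1/2" "1/2"] by (simp only:)
  have "(indicator C x * (1 + sin (f x))) *\<^sub>R cis (t * y x)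
      = G (\<lambda>x. t * y x) x + (- \<i> / 2) * G (\<lambda>x. f x + t * y x) x + (\<i> / 2) * G (\<lambda>x. t * y x - f x) x" for x t
    using one_plus_sin_scaleR_cis[of "f x" "t * y x"] 
    by (cases "x \<in> C") (simp_all only: G_def indicator_simps not_False_eq_True mult_1 mult_zero_left mult_zero_right scaleR_zero_left scaleR_one add_0)
  then have w2: "(LINT x|\<mu>. (indicator C x * (1 + sin (f x))) *\<^sub>R cis (t * y x))
      = (LINT x|\<nu>. (indicator C x * (1 + sin (f x))) *\<^sub>R cis (t * y x))" for t
    using comb[of t "- \<i> / 2" "\<i> / 2"] by (simp only:)
  have transfer: "(LINT x|\<mu>. indicator C x * g x * indicator A (y x))
        = (LINT x|\<nu>. indicator C x * g x * indicator A (y x))"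
    if g [measurable]: "g \<in> borel_measurable borel" and b: "\<And>x. 0 \<le> g x" "\<And>x. g x \<le> 2"
      and c: "\<And>t. (LINT x|\<mu>. (indicator C x * g x) *\<^sub>R cis (t * y x))
        = (LINT x|\<nu>. (indicator C x * g x) *\<^sub>R cis (t * y x))"
    for g :: "'b \<Rightarrow> real"
  proof (rule integral_weighted_vimage_eq_if_char_eq[where K = 2])
    show "(\<lambda>x. indicator C x * g x) \<in> borel_measurable \<mu>" "y \<in> borel_measurable \<mu>" by simp_all
    show "0 \<le> indicator C x * g x" "indicator C x * g x \<le> 2" for x
      using b[of x] by (simp_all split: split_indicator)
  qed (fact | rule c | simp)+
  have b: "0 \<le> 1 + cos u" "0 \<le> 1 + sin u" "1 + cos u \<le> 2" "1 + sin u \<le> 2" for u :: real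
    using cos_ge_minus_one[of u] sin_ge_minus_one[of u] cos_le_one[of u] sin_le_one[of u] by linarith+
  have m: "(\<lambda>x. 1 + cos (f x)) \<in> borel_measurable borel" "(\<lambda>x. 1 + sin (f x)) \<in> borel_measurable borel"
    "(\<lambda>x. 1) \<in> borel_measurable borel"
    by measurable
  have i0: "(LINT x|\<mu>. indicator C x * 1 * indicator A (y x) :: real) = (LINT x|\<nu>. indicator C x * 1 * indicator A (y x))"
    using w0 by (intro transfer[of "\<lambda>_. 1"]) (simp_all only: mult_1_right zero_le_one one_le_numeral borel_measurable_const)
  have i1: "(LINT x|\<mu>. indicator C x * (1 + cos (f x)) * indicator A (y x))
      = (LINT x|\<nu>. indicator C x * (1 + cos (f x)) * indicator A (y x))"
    by (rule transfer[OF m(1) b(1) b(3) w1])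
  have i2: "(LINT x|\<mu>. indicator C x * (1 + sin (f x)) * indicator A (y x))
      = (LINT x|\<nu>. indicator C x * (1 + sin (f x)) * indicator A (y x))"
    by (rule transfer[OF m(2) b(2) b(4) w2])
  have ii: "integrable \<mu> (\<lambda>x. indicator C x * g x * indicator A (y x))"
      "integrable \<nu> (\<lambda>x. indicator C x * g x * indicator A (y x))"
    if g [measurable]: "g \<in> borel_measurable borel" and b: "\<And>x. 0 \<le> g x" "\<And>x. g x \<le> 2" for g :: "'b \<Rightarrow> real"
  proof -
    have "norm (indicator C x * g x * indicator A (y x)) \<le> 2" for x
      using b[of x] by (simp split: split_indicator)
    then show "integrable \<mu> (\<lambda>x. indicator C x * g x * indicator A (y x))"
      "integrable \<nu> (\<lambda>x. indicator C x * g x * indicator A (y x))"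
      by (intro int; measurable)+
  qed
  \<comment> \<open>Subtracting the weight 1 again from \<open>1 + cos\<close> and
    \<open>1 + sin\<close> recovers the real and imaginary parts of the character, so three
    nonnegative weights determine the complex integral.\<close>
  have split: "indicator (C \<inter> y -` A) x *\<^sub>R cis (f x)
      = complex_of_real (indicator C x * (1 + cos (f x)) * indicator A (y x) - indicator C x * 1 * indicator A (y x))
       + \<i> * complex_of_real (indicator C x * (1 + sin (f x)) * indicator A (y x) - indicator C x * 1 * indicator A (y x))"
    for x by (auto simp: complex_eq_iff split: split_indicator)
  have *: "(LINT x|L. indicator (C \<inter> y -` A) x *\<^sub>R cis (f x))
      = complex_of_real ((LINT x|L. indicator C x * (1 + cos (f x)) * indicator A (y x))
            - (LINT x|L. indicator C x * 1 * indicator A (y x)))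
        + \<i> * complex_of_real ((LINT x|L. indicator C x * (1 + sin (f x)) * indicator A (y x))
            - (LINT x|L. indicator C x * 1 * indicator A (y x)))"
    if I: "integrable L (\<lambda>x. indicator C x * (1 + cos (f x)) * indicator A (y x))"
      "integrable L (\<lambda>x. indicator C x * (1 + sin (f x)) * indicator A (y x))"
      "integrable L (\<lambda>x. indicator C x * 1 * indicator A (y x) :: real)" for L
  proof -
    note D = Bochner_Integration.integrable_diff[OF I(1) I(3)] Bochner_Integration.integrable_diff[OF I(2) I(3)]
    show ?thesis
      unfolding split
      by (subst Bochner_Integration.integral_add
          Bochner_Integration.integral_diff[OF I(1) I(3), symmetric]
          Bochner_Integration.integral_diff[OF I(2) I(3), symmetric];
          (intro integrable_of_real integrable_mult_right D)?)+
        (simp only: integral_mult_right_zero integral_complex_of_real)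
  qed
  have b1: "(0::real) \<le> 1" "(1::real) \<le> 2" by simp_all
  show ?case
    unfolding *[OF ii(1)[OF m(1) b(1) b(3)] ii(1)[OF m(2) b(2) b(4)] ii(1)[OF m(3) b1]]
      *[OF ii(2)[OF m(1) b(1) b(3)] ii(2)[OF m(2) b(2) b(4)] ii(2)[OF m(3) b1]] i0 i1 i2
    by (rule refl)
qed

text \<open>Over an infinite measure the integral of the constant 1 is 0 by convention, so the value
  1 excludes infinite total mass and fixes the mass at once.\<close>

lemma prob_space_if_char_zero:
  fixes \<mu> :: "'b::real_normed_vector measure"
  assumes "(LINT x|\<mu>. cis 0) = 1"
  shows "prob_space \<mu>"
proof (rule prob_spaceI)
  have "measure \<mu> (space \<mu>) = 1"
    using assms by (simp add: scaleR_conv_of_real)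
  then show "emeasure \<mu> (space \<mu>) = 1"
    by (metis emeasure_eq_ennreal_measure ennreal_1 measure_eq_emeasure_eq_ennreal measure_zero_top zero_neq_one)
qed

lemma measure_eqI_char_functional:
  fixes \<mu> \<nu> :: "'b::real_normed_vector measure"
  assumes D: "countable (D :: 'b set)" "closure D = UNIV"
    and fin: "finite_measure \<mu>" "finite_measure \<nu>"
    and sets: "sets \<mu> = sets borel" "sets \<nu> = sets borel"
    and char: "\<And>f. bounded_linear f \<Longrightarrow> (LINT x|\<mu>. cis (f x)) = (LINT x|\<nu>. cis (f x))"
  shows "\<mu> = \<nu>"
proof -
  interpret \<mu>: finite_measure \<mu> by fact
  interpret \<nu>: finite_measure \<nu> by fact
  have eq: "emeasure \<mu> C = emeasure \<nu> C" if C: "C \<in> cylinder_sets" for C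
  proof -
    have [simp]: "C \<in> sets \<mu>" "C \<in> sets \<nu>" using C sets cylinder_sets_in_borel by auto
    have "space \<mu> = UNIV" "space \<nu> = UNIV"
      using sets sets_eq_imp_space_eq[of _ "borel :: 'b measure"] by auto
    \<comment> \<open>The zero functional turns the character into the constant 1, leaving the
      measures of \<open>C\<close>.\<close>
    then have "measure \<mu> C = measure \<nu> C"
      using integral_cylinder_cis_eq[OF fin sets char C bounded_linear_zero]
      by (simp add: scaleR_conv_of_real)
    then show ?thesis by (simp add: \<mu>.emeasure_eq_measure \<nu>.emeasure_eq_measure)
  qed
  show ?thesis
  proof (rule measure_eqI_generator_eq[where A = "\<lambda>_. UNIV" and \<Omega> = UNIV])
    show "Int_stable (cylinder_sets :: 'b set set)" by (rule Int_stable_cylinder_sets)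
    show "sets \<mu> = sigma_sets UNIV cylinder_sets" "sets \<nu> = sigma_sets UNIV cylinder_sets"
      using sets sets_borel_eq_cylinder_sets[OF D] by auto
  qed (use eq in \<open>auto intro: cylinder_sets.UNIV\<close>)
qed

section \<open>Orthogonal projections and Gram--Schmidt families\<close>

text \<open>Moving from \<open>m\<close> by the component \<open>?t\<close> of \<open>h - m\<close>
  along \<open>y\<close> would lower the squared distance by
  \<open>?c^2 / inner y y\<close>.\<close>

lemma subspace_nearest_orthogonal:
  fixes M :: "'a::real_inner set"
  assumes M: "subspace M" and m: "m \<in> M" and near: "\<And>z. z \<in> M \<Longrightarrow> norm (h - m) \<le> norm (h - z)"
    and y: "y \<in> M"
  shows "inner (h - m) y = 0"
proof (rule ccontr)
  let ?c = "inner (h - m) y" and ?t = "inner (h - m) y / inner y y"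
  assume c: "?c \<noteq> 0"
  then have y0: "inner y y > 0" by auto
  have "m + ?t *\<^sub>R y \<in> M" using M m y by (simp add: subspace_add subspace_scale)
  then have "norm (h - m) \<le> norm (h - m - ?t *\<^sub>R y)"
    using near by (metis diff_diff_eq)
  then have "inner (h - m) (h - m) \<le> inner (h - m - ?t *\<^sub>R y) (h - m - ?t *\<^sub>R y)"
    by (simp add: norm_eq_sqrt_inner)
  also have "\<dots> = inner (h - m) (h - m) - 2 * (?t * ?c) + ?t * (?t * inner y y)"
    by (simp only: inner_diff_left inner_diff_right inner_scaleR_left inner_scaleR_right inner_commute)
  also have "\<dots> = inner (h - m) (h - m) - ?c\<^sup>2 / inner y y"
    using y0 by (simp add: power2_eq_square field_simps)
  finally show False using c y0 by (simp add: divide_le_0_iff)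
qed

text \<open>A minimising sequence is Cauchy by the parallelogram law, because the midpoint of two
  members is again in the subspace and no closer to \<open>h\<close> than the infimum
  allows.\<close>

lemma exists_orthogonal_projection:
  fixes M :: "'h::{real_inner, complete_space} set"
  assumes M: "subspace M" "closed M"
  shows "\<exists>m\<in>M. \<forall>y\<in>M. inner (h - m) y = 0"
proof -
  define \<delta> where "\<delta> = (INF m\<in>M. (norm (h - m))\<^sup>2)"
  have "M \<noteq> {}" using M(1) subspace_0 by blast
  have bdd: "bdd_below ((\<lambda>m. (norm (h - m))\<^sup>2) ` M)" by (rule bdd_belowI2[of _ 0]) simp
  have low: "\<delta> \<le> (norm (h - m))\<^sup>2" if "m \<in> M" for m
    unfolding \<delta>_def by (rule cINF_lower[OF bdd that])
  have "\<exists>m\<in>M. (norm (h - m))\<^sup>2 < \<delta> + inverse (real (Suc n))" for n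
    using cINF_less_iff[OF \<open>M \<noteq> {}\<close> bdd, of "\<delta> + inverse (real (Suc n))"] by (simp add: \<delta>_def)
  then obtain m where m: "\<And>n. m n \<in> M" "\<And>n. (norm (h - m n))\<^sup>2 < \<delta> + inverse (real (Suc n))"
    by metis
  have para: "(norm (a - b))\<^sup>2 = 2 * (norm a)\<^sup>2 + 2 * (norm b)\<^sup>2 - 4 * (norm ((1/2) *\<^sub>R (a + b)))\<^sup>2"
    for a b :: 'h
    by (simp add: power2_norm_eq_inner inner_diff_left inner_diff_right inner_add_left inner_add_right
        inner_commute algebra_simps)
  have dist: "(norm (m k - m n))\<^sup>2 \<le> 2 * inverse (real (Suc n)) + 2 * inverse (real (Suc k))" for n k
  proof -
    have "(1/2) *\<^sub>R (m n + m k) \<in> M" using M(1) m(1) by (simp add: subspace_add subspace_scale)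
    then have "\<delta> \<le> (norm (h - (1/2) *\<^sub>R (m n + m k)))\<^sup>2" by (rule low)
    also have "h - (1/2) *\<^sub>R (m n + m k) = (1/2) *\<^sub>R ((h - m n) + (h - m k))"
      by (simp add: scaleR_right_diff_distrib scaleR_right_distrib)
        (metis scaleR_half_double scaleR_add_right)
    finally show ?thesis
      using para[of "h - m n" "h - m k"] m(2)[of n] m(2)[of k] by simp
  qed
  have "Cauchy m"
    unfolding Cauchy_def
  proof (intro allI impI)
    fix e :: real assume "e > 0"
    \<comment> \<open>The bound \<open>dist\<close> contributes two terms, each twice an inverse,
      hence the factor 4.\<close>
    then obtain K where K: "inverse (real (Suc K)) < e\<^sup>2 / 4"
      using reals_Archimedean[of "e\<^sup>2 / 4"] by auto
    have "dist (m a) (m b) < e" if "a \<ge> K" "b \<ge> K" for a b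
    proof -
      have "inverse (real (Suc a)) \<le> inverse (real (Suc K))" "inverse (real (Suc b)) \<le> inverse (real (Suc K))"
        using that by (auto intro!: le_imp_inverse_le)
      then have "(norm (m a - m b))\<^sup>2 < e\<^sup>2" using dist[of a b] K by linarith
      then show ?thesis using \<open>e > 0\<close> by (simp add: dist_norm power_less_imp_less_base)
    qed
    then show "\<exists>K. \<forall>a\<ge>K. \<forall>b\<ge>K. dist (m a) (m b) < e" by blast
  qed
  then obtain l where l: "m \<longlonglongrightarrow> l" using Cauchy_convergent convergent_def by blast
  have lM: "l \<in> M" using closed_sequentially[OF M(2)] m(1) l by blast
  have "(\<lambda>n. (norm (h - m n))\<^sup>2) \<longlonglongrightarrow> (norm (h - l))\<^sup>2" by (intro tendsto_intros l)
  moreover have "(\<lambda>n. \<delta> + inverse (real (Suc n))) \<longlonglongrightarrow> \<delta> + 0"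
    by (intro tendsto_intros LIMSEQ_inverse_real_of_nat)
  ultimately have le: "(norm (h - l))\<^sup>2 \<le> \<delta> + 0"
    by (rule LIMSEQ_le) (use m(2) in \<open>auto intro: less_imp_le\<close>)
  have "norm (h - l) \<le> norm (h - z)" if "z \<in> M" for z
    by (rule power2_le_imp_le[OF order_trans[OF le]]) (use low[OF that] in auto)
  then show ?thesis
    using subspace_nearest_orthogonal[OF M(1) lM] lM by blast
qed

context
  fixes M :: "'h::{real_inner, complete_space} set"
  assumes M: "subspace M" "closed M"
begin

lemma orth_proj_eqI:
  assumes "m \<in> M" "\<And>y. y \<in> M \<Longrightarrow> inner (h - m) y = 0"
  shows "orth_proj M h = m"
  unfolding orth_proj_def
proof (rule the_equality)
  fix m' assume m': "m' \<in> M \<and> (\<forall>y\<in>M. inner (h - m') y = 0)"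
  then have d: "m' - m \<in> M" using assms M by (simp add: subspace_diff)
  have "inner (m' - m) (m' - m) = inner (h - m) (m' - m) - inner (h - m') (m' - m)"
    by (simp add: inner_diff_left)
  also have "\<dots> = 0" using assms m' d by simp
  finally show "m' = m" by simp
qed (use assms in auto)

lemma orth_proj_mem: "orth_proj M h \<in> M"
  and orth_proj_orthogonal: "y \<in> M \<Longrightarrow> inner (h - orth_proj M h) y = 0"
proof -
  obtain m where m: "m \<in> M" "\<forall>y\<in>M. inner (h - m) y = 0"
    using exists_orthogonal_projection[OF M] by blast
  then have "orth_proj M h = m" by (intro orth_proj_eqI) auto
  with m show "orth_proj M h \<in> M" "y \<in> M \<Longrightarrow> inner (h - orth_proj M h) y = 0" by auto
qed

lemma inner_orth_proj: "y \<in> M \<Longrightarrow> inner (orth_proj M h) y = inner h y"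
  using orth_proj_orthogonal[of y h] by (simp add: inner_diff_left)

lemma orth_proj_id: "m \<in> M \<Longrightarrow> orth_proj M m = m"
  by (rule orth_proj_eqI) auto

lemma norm_orth_proj_le: "norm (orth_proj M h) \<le> norm h"
proof -
  have "inner (orth_proj M h) (orth_proj M h) = inner h (orth_proj M h)"
    by (rule inner_orth_proj[OF orth_proj_mem])
  then have "norm (orth_proj M h) * norm (orth_proj M h) \<le> norm h * norm (orth_proj M h)"
    using norm_cauchy_schwarz[of h "orth_proj M h"] by (simp add: dot_square_norm power2_eq_square)
  then show ?thesis by (cases "norm (orth_proj M h) = 0") auto
qed

lemma bounded_linear_orth_proj: "bounded_linear (orth_proj M)"
proof (rule bounded_linear_intro[where K = 1])
  show "orth_proj M (x + y) = orth_proj M x + orth_proj M y" for x y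
    using M by (intro orth_proj_eqI)
      (auto simp: subspace_add orth_proj_mem inner_diff_left inner_add_left inner_orth_proj)
  show "orth_proj M (c *\<^sub>R x) = c *\<^sub>R orth_proj M x" for c x
    using M by (intro orth_proj_eqI)
      (auto simp: subspace_scale orth_proj_mem inner_diff_left inner_orth_proj)
qed (simp add: norm_orth_proj_le)

end

text \<open>Zero vectors are allowed in orthonormal families: Gram--Schmidt then needs no linear
  independence, and finite- and infinite-dimensional spaces are treated alike.\<close>

definition partial_orthonormal :: "(nat \<Rightarrow> 'a::real_inner) \<Rightarrow> bool" where
  "partial_orthonormal e \<longleftrightarrow>
     (\<forall>i j. i \<noteq> j \<longrightarrow> inner (e i) (e j) = 0) \<and> (\<forall>i. e i = 0 \<or> norm (e i) = 1)"

text \<open>\<open>sgn\<close> normalises nonzero vectors and fixes 0, so a vector dependent on its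
  predecessors yields a zero vector.\<close>

fun gram_schmidt :: "(nat \<Rightarrow> 'a::real_inner) \<Rightarrow> nat \<Rightarrow> 'a" where
  "gram_schmidt d n = sgn (d n - (\<Sum>i<n. inner (d n) (gram_schmidt d i) *\<^sub>R gram_schmidt d i))"

declare gram_schmidt.simps [simp del]

definition fourier_sum :: "(nat \<Rightarrow> 'a::real_inner) \<Rightarrow> nat \<Rightarrow> 'a \<Rightarrow> 'a" where
  "fourier_sum e n h = (\<Sum>i<n. inner h (e i) *\<^sub>R e i)"

lemma inner_self_scaleR_unit_or_zero:
  fixes v :: "'a::real_inner"
  shows "v = 0 \<or> norm v = 1 \<Longrightarrow> inner v v *\<^sub>R v = v"
  by (auto simp: dot_square_norm)

text \<open>Orthogonality is required only below \<open>n\<close>, because the lemma is applied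
  inside the induction that establishes it for Gram--Schmidt.\<close>

lemma inner_fourier_sum:
  assumes orth: "\<And>i j. i < n \<Longrightarrow> j < n \<Longrightarrow> i \<noteq> j \<Longrightarrow> inner (e i) (e j) = 0"
    and unit: "\<And>i. i < n \<Longrightarrow> e i = 0 \<or> norm (e i) = 1" and k: "k < n"
  shows "inner (fourier_sum e n h) (e k) = inner h (e k)"
proof -
  have "inner (fourier_sum e n h) (e k) = (\<Sum>i<n. inner h (e i) * inner (e i) (e k))"
    by (simp add: fourier_sum_def inner_sum_left)
  also have "\<dots> = (\<Sum>i<n. if i = k then inner h (e k) * inner (e k) (e k) else 0)"
    by (intro sum.cong) (use orth k in auto)
  also have "\<dots> = inner h (inner (e k) (e k) *\<^sub>R e k)" using k by simp
  also have "\<dots> = inner h (e k)" using unit[OF k] by (simp only: inner_self_scaleR_unit_or_zero)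
  finally show ?thesis .
qed

lemma gram_schmidt_unit_or_zero: "gram_schmidt d n = 0 \<or> norm (gram_schmidt d n) = 1"
  by (subst (1 2) gram_schmidt.simps) (simp add: norm_sgn)

lemma gram_schmidt_eq_sgn: "gram_schmidt d n = sgn (d n - fourier_sum (gram_schmidt d) n (d n))"
  by (subst gram_schmidt.simps) (simp add: fourier_sum_def)

lemma gram_schmidt_orthogonal: "j < n \<Longrightarrow> inner (gram_schmidt d n) (gram_schmidt d j) = 0"
proof (induction n arbitrary: j rule: less_induct)
  case (less n)
  have "inner (gram_schmidt d i) (gram_schmidt d k) = 0" if "i < n" "k < n" "i \<noteq> k" for i k
    using less.IH[of i k] less.IH[of k i] that by (metis inner_commute linorder_neqE_nat)
  then have "inner (fourier_sum (gram_schmidt d) n (d n)) (gram_schmidt d j) = inner (d n) (gram_schmidt d j)"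
    using less.prems by (intro inner_fourier_sum gram_schmidt_unit_or_zero) auto
  then show ?case
    by (subst gram_schmidt_eq_sgn) (simp add: sgn_div_norm inner_diff_left)
qed

lemma partial_orthonormal_gram_schmidt: "partial_orthonormal (gram_schmidt d)"
  unfolding partial_orthonormal_def
  using gram_schmidt_orthogonal gram_schmidt_unit_or_zero
  by (metis inner_commute linorder_neqE_nat)

lemma span_gram_schmidt: "span (gram_schmidt d ` {..<n}) = span (d ` {..<n})"
proof (induction n)
  case (Suc n)
  let ?e = "gram_schmidt d"
  let ?v = "d n - fourier_sum ?e n (d n)"
  have F: "fourier_sum ?e n (d n) \<in> span (?e ` {..<n})"
    unfolding fourier_sum_def by (intro span_sum span_scale span_base) auto
  \<comment> \<open>Valid also for a vanishing remainder, where the last term is zero.\<close>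
  have "d n = fourier_sum ?e n (d n) + norm ?v *\<^sub>R ?e n"
    using gram_schmidt_eq_sgn[of d n] by (cases "?v = 0") (simp_all add: sgn_div_norm)
  also have "\<dots> \<in> span (?e ` {..<Suc n})"
  proof (intro span_add span_scale)
    show "fourier_sum ?e n (d n) \<in> span (?e ` {..<Suc n})"
      by (rule subsetD[OF span_mono F]) auto
  qed (auto intro: span_base)
  finally have 1: "d n \<in> span (?e ` {..<Suc n})" .
  have "?e n = (1 / norm ?v) *\<^sub>R ?v"
    by (subst gram_schmidt_eq_sgn) (simp add: sgn_div_norm divide_inverse)
  also have "\<dots> \<in> span (d ` {..<Suc n})"
  proof (intro span_diff span_scale)
    show "fourier_sum ?e n (d n) \<in> span (d ` {..<Suc n})"
      by (rule subsetD[OF span_mono F[unfolded Suc]]) auto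
  qed (auto intro: span_base)
  finally have 2: "?e n \<in> span (d ` {..<Suc n})" .
  show ?case
  proof (rule span_eq[THEN iffD2], intro conjI)
    show "?e ` {..<Suc n} \<subseteq> span (d ` {..<Suc n})"
    proof -
      have "?e ` {..<n} \<subseteq> span (d ` {..<n})" using Suc span_superset by metis
      also have "\<dots> \<subseteq> span (d ` {..<Suc n})" by (rule span_mono) auto
      finally show ?thesis using 2 by (auto simp: lessThan_Suc)
    qed
    show "d ` {..<Suc n} \<subseteq> span (?e ` {..<Suc n})"
    proof -
      have "d ` {..<n} \<subseteq> span (?e ` {..<n})" using Suc span_superset by metis
      also have "\<dots> \<subseteq> span (?e ` {..<Suc n})" by (rule span_mono) auto
      finally show ?thesis using 1 by (auto simp: lessThan_Suc)
    qed
  qed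
qed simp

lemma gram_schmidt_mem:
  assumes "subspace M" "\<And>i. d i \<in> M"
  shows "gram_schmidt d i \<in> M"
proof -
  have "gram_schmidt d i \<in> span (gram_schmidt d ` {..<Suc i})" by (rule span_base) simp
  also have "\<dots> = span (d ` {..<Suc i})" by (rule span_gram_schmidt)
  also have "\<dots> \<subseteq> M" using assms by (intro span_minimal) auto
  finally show ?thesis .
qed

section \<open>Best approximation and Fourier expansion\<close>

context
  fixes e :: "nat \<Rightarrow> 'a::real_inner"
  assumes e: "partial_orthonormal e"
begin

lemma fourier_sum_orthogonal: "k < n \<Longrightarrow> inner (h - fourier_sum e n h) (e k) = 0"
  using inner_fourier_sum[of n e k h] e by (simp add: partial_orthonormal_def inner_diff_left)

lemma fourier_sum_orthogonal_span:
  assumes "y \<in> span (e ` {..<n})"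
  shows "inner (h - fourier_sum e n h) y = 0"
  using assms by (induction rule: span_induct_alt)
    (auto simp: inner_add_right fourier_sum_orthogonal)

text \<open>An inequality and not an equality, since coefficients of zero vectors count only on the
  right.\<close>

lemma norm_sum_partial_orthonormal_le:
  "(norm (\<Sum>i<n. a i *\<^sub>R e i))\<^sup>2 \<le> (\<Sum>i<n. (a i)\<^sup>2)"
proof -
  have "(norm (\<Sum>i<n. a i *\<^sub>R e i))\<^sup>2 = (\<Sum>i<n. \<Sum>j<n. a i * (a j * inner (e i) (e j)))"
    by (simp add: power2_norm_eq_inner inner_sum_left inner_sum_right sum_distrib_left
        inner_commute) (intro sum.cong refl mult.left_commute)
  also have "\<dots> = (\<Sum>i<n. \<Sum>j<n. if j = i then a i * (a i * inner (e i) (e i)) else 0)"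
    by (intro sum.cong) (use e in \<open>auto simp: partial_orthonormal_def\<close>)
  also have "\<dots> = (\<Sum>i<n. (a i)\<^sup>2 * inner (e i) (e i))"
    by (simp add: power2_eq_square mult.assoc)
  also have "\<dots> \<le> (\<Sum>i<n. (a i)\<^sup>2)"
  proof (rule sum_mono)
    fix i
    have "e i = 0 \<or> norm (e i) = 1" using e by (simp add: partial_orthonormal_def)
    then have "inner (e i) (e i) \<le> 1" by (auto simp: dot_square_norm)
    then show "(a i)\<^sup>2 * inner (e i) (e i) \<le> (a i)\<^sup>2" by (simp add: mult_left_le)
  qed
  finally show ?thesis .
qed

lemma norm_partial_orthonormal_le_one: "norm (e i) \<le> 1"
  using e unfolding partial_orthonormal_def by (metis norm_zero order_refl zero_le_one)

lemma fourier_sum_in_span: "fourier_sum e n h \<in> span (e ` {..<n})"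
  unfolding fourier_sum_def by (intro span_sum span_scale span_base) auto

lemma norm_fourier_sum_best:
  assumes y: "y \<in> span (e ` {..<n})"
  shows "norm (h - fourier_sum e n h) \<le> norm (h - y)"
proof -
  let ?F = "fourier_sum e n h"
  have "?F - y \<in> span (e ` {..<n})" by (intro span_diff fourier_sum_in_span y)
  then have "inner (h - ?F) (?F - y) = 0" by (rule fourier_sum_orthogonal_span)
  then have "(norm ((h - ?F) + (?F - y)))\<^sup>2 = (norm (h - ?F))\<^sup>2 + (norm (?F - y))\<^sup>2"
    by (simp only: power2_norm_eq_inner inner_add_left inner_add_right
        inner_commute[of "?F - y" "h - ?F"])
  then have "(norm (h - ?F))\<^sup>2 \<le> (norm (h - y))\<^sup>2" by simp
  then show ?thesis by (rule power2_le_imp_le) simp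
qed

end

text \<open>The Fourier sum is the best approximation of the projection of \<open>h\<close> from the
  span, which eventually contains the projection of any chosen \<open>d m\<close>; as projecting
  does not increase norms, that competitor is as close as \<open>d m\<close> is to
  \<open>h\<close>.\<close>

lemma fourier_sum_tendsto_orth_proj:
  fixes M :: "'h::{real_inner, complete_space} set" and d :: "nat \<Rightarrow> 'h"
  assumes M: "subspace M" "closed M" and d: "closure (range d) = UNIV"
  defines "e \<equiv> gram_schmidt (\<lambda>i. orth_proj M (d i))"
  shows "(\<lambda>n. fourier_sum e n h) \<longlonglongrightarrow> orth_proj M h"
proof (rule LIMSEQ_I)
  fix r :: real assume "r > 0"
  let ?P = "orth_proj M"
  have e: "partial_orthonormal e" unfolding e_def by (rule partial_orthonormal_gram_schmidt)
  have span: "span (e ` {..<n}) = span ((\<lambda>i. ?P (d i)) ` {..<n})" for n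
    unfolding e_def by (rule span_gram_schmidt)
  have eM: "e i \<in> M" for i
    unfolding e_def by (intro gram_schmidt_mem M orth_proj_mem)
  \<comment> \<open>The \<open>e i\<close> lie in \<open>M\<close>, so \<open>h\<close> and its
    projection have the same coefficients.\<close>
  have fs: "fourier_sum e n (?P h) = fourier_sum e n h" for n
    unfolding fourier_sum_def by (simp add: inner_orth_proj[OF M eM])
  have "h \<in> closure (range d)" using d by simp
  then obtain m where m: "dist (d m) h < r" using \<open>r > 0\<close> unfolding closure_approachable by blast
  have "norm (fourier_sum e n h - ?P h) < r" if "n \<ge> Suc m" for n
  proof -
    have "?P (d m) \<in> span (e ` {..<n})"
      unfolding span using that by (intro span_base) auto
    then have "norm (?P h - fourier_sum e n (?P h)) \<le> norm (?P h - ?P (d m))"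
      by (rule norm_fourier_sum_best[OF e])
    also have "\<dots> = norm (?P (h - d m))"
      by (simp add: bounded_linear.linear[OF bounded_linear_orth_proj[OF M]] linear_diff)
    also have "\<dots> \<le> norm (h - d m)" by (rule norm_orth_proj_le[OF M])
    also have "\<dots> < r" using m by (simp add: dist_norm norm_minus_commute)
    finally show ?thesis by (simp add: fs norm_minus_commute)
  qed
  then show "\<exists>k. \<forall>n\<ge>k. norm (fourier_sum e n h - ?P h) < r" by blast
qed

text \<open>The vectors \<open>v n\<close> are truncations of the Riesz representer of the
  functional. Evaluating it at \<open>v n\<close> gives \<open>s n \<le> b * sqrt (s n)\<close>,
  hence \<open>s n \<le> b^2\<close>; conversely \<open>L (fourier_sum e n h)\<close> is the inner
  product of \<open>h\<close> with \<open>v n\<close>, and Cauchy--Schwarz in the limit bounds the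
  norm by the root of the limit \<open>S\<close>.\<close>

lemma sum_squares_tendsto_onorm_orth_proj:
  fixes M :: "'h::{real_inner, complete_space} set" and L :: "'h \<Rightarrow> real"
  assumes M: "subspace M" "closed M" and e: "partial_orthonormal e" and eM: "\<And>i. e i \<in> M"
    and conv: "\<And>h. (\<lambda>n. fourier_sum e n h) \<longlonglongrightarrow> orth_proj M h"
    and L: "bounded_linear L"
  shows "(\<lambda>n. \<Sum>i<n. (L (e i))\<^sup>2) \<longlonglongrightarrow> (onorm (\<lambda>h. L (orth_proj M h)))\<^sup>2"
proof -
  let ?f = "\<lambda>h. L (orth_proj M h)"
  have f: "bounded_linear ?f"
    using bounded_linear_compose[OF L bounded_linear_orth_proj[OF M]] .
  have fL: "?f (e i) = L (e i)" for i by (simp add: orth_proj_id[OF M eM])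
  define b where "b = onorm ?f"
  have b: "b \<ge> 0" unfolding b_def by (rule onorm_pos_le[OF f])
  define s where "s n = (\<Sum>i<n. (L (e i))\<^sup>2)" for n
  define v where "v n = (\<Sum>i<n. L (e i) *\<^sub>R e i)" for n
  have s0: "s n \<ge> 0" for n unfolding s_def by (simp add: sum_nonneg)
  have vs: "norm (v n) \<le> sqrt (s n)" for n
    using norm_sum_partial_orthonormal_le[OF e, where a = "\<lambda>i. L (e i)" and n = n]
    unfolding v_def s_def by (rule real_le_rsqrt)
  have sb: "s n \<le> b\<^sup>2" for n
  proof -
    have "?f (v n) = s n"
      unfolding v_def s_def
      by (simp add: linear_sum[OF bounded_linear.linear[OF f]] linear_scale[OF bounded_linear.linear[OF f]]
          fL power2_eq_square)
    then have "s n \<le> b * norm (v n)"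
      using onorm[OF f, of "v n"] s0[of n] by (simp add: b_def)
    also have "\<dots> \<le> b * sqrt (s n)" using vs b by (rule mult_left_mono)
    finally have "sqrt (s n) * sqrt (s n) \<le> b * sqrt (s n)" using s0[of n] by simp
    then have "sqrt (s n) \<le> b"
      using b s0[of n] mult_right_le_imp_le[of "sqrt (s n)" "sqrt (s n)" b]
      by (cases "s n = 0") auto
    then have "(sqrt (s n))\<^sup>2 \<le> b\<^sup>2" using s0[of n] by (intro power_mono) auto
    then show ?thesis using s0[of n] by simp
  qed
  have "incseq s" unfolding s_def by (intro incseq_SucI) simp
  then obtain S where S: "s \<longlonglongrightarrow> S" "\<And>n. s n \<le> S"
    using incseq_convergent[of s "b\<^sup>2"] sb by auto
  have "S \<le> b\<^sup>2" by (rule LIMSEQ_le_const2[OF S(1)]) (use sb in auto)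
  have S0: "S \<ge> 0" using s0[of 0] S(2)[of 0] by linarith
  have "norm (?f h) \<le> sqrt S * norm h" for h
  proof -
    have "(\<lambda>n. norm (L (fourier_sum e n h))) \<longlonglongrightarrow> norm (?f h)"
      by (intro tendsto_norm bounded_linear.tendsto[OF L] conv)
    moreover have "norm (L (fourier_sum e n h)) \<le> sqrt S * norm h" for n
    proof -
      have "L (fourier_sum e n h) = inner h (v n)"
        unfolding fourier_sum_def v_def
        by (simp add: linear_sum[OF bounded_linear.linear[OF L]] linear_scale[OF bounded_linear.linear[OF L]]
            inner_sum_right mult.commute)
      also have "norm \<dots> \<le> norm h * norm (v n)" using Cauchy_Schwarz_ineq2[of h "v n"] by simp
      also have "\<dots> \<le> norm h * sqrt S"
        using vs[of n] S(2)[of n] by (intro mult_left_mono) (auto intro: order_trans)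
      finally show ?thesis by (simp add: mult.commute)
    qed
    ultimately show ?thesis by (intro LIMSEQ_le_const2[of _ "norm (?f h)"]) auto
  qed
  then have "b \<le> sqrt S" unfolding b_def using S0 by (intro onorm_bound) auto
  then have "b\<^sup>2 \<le> S" using power_mono[of b "sqrt S" 2] b S0 by simp
  with \<open>S \<le> b\<^sup>2\<close> S(1) show ?thesis by (simp add: s_def[abs_def] b_def)
qed

section \<open>Measurable norms\<close>

lemma std_normal_small_ball:
  assumes "a \<ge> 0"
  shows "measure std_normal_distribution {x. \<bar>x\<bar> \<le> a} \<le> 2 * a"
proof -
  have eq: "{x. \<bar>x\<bar> \<le> a} = {- a..a}" by auto
  have "std_normal_density x \<le> 1" for x :: real
  proof -
    have "1 \<le> sqrt (2 * pi)" using pi_gt3 by simp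
    then have "1 / sqrt (2 * pi) \<le> 1" by simp
    moreover have "exp (- x\<^sup>2 / 2) \<le> (1::real)" by simp
    ultimately show ?thesis unfolding std_normal_density_def by (intro mult_le_one) auto
  qed
  then have "emeasure std_normal_distribution {- a..a} \<le> (\<integral>\<^sup>+x. indicator {- a..a} x \<partial>lborel)"
    by (subst emeasure_density)
      (simp_all del: nn_integral_indicator add: nn_integral_mono split: split_indicator)
  also have "\<dots> = ennreal (2 * a)" using assms by simp
  finally show ?thesis
    unfolding eq using assms by (simp add: measure_def enn2real_leI)
qed

lemma prob_space_std_normal: "prob_space std_normal_distribution"
  by (rule prob_space_normal_density) simp

text \<open>On the line through \<open>v\<close> the norm of a Gaussian vector is
  \<open>\<bar>x\<bar> * N v\<close>. If \<open>N v > 2\<close>, it is at most 1/2 only when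
  \<open>\<bar>x\<bar> \<le> 1/4\<close>, an event of probability at most 1/2 because the normal
  density is below 1; this contradicts the tolerance 1/2.\<close>

lemma measurable_norm_bound_on_orthogonal:
  fixes N :: "'a::real_inner \<Rightarrow> real"
  assumes N: "is_norm_on N"
    and F0: "\<And>F1 k e. fin_dim_subspace F1 \<Longrightarrow> \<forall>x\<in>F1. \<forall>y\<in>F0. inner x y = 0 \<Longrightarrow>
      orthonormal_basis_of F1 k e \<Longrightarrow> gauss_fin k e {v\<in>F1. N v > 1/2} < 1/2"
    and v: "norm v = 1" "\<And>y. y \<in> F0 \<Longrightarrow> inner v y = 0"
  shows "N v \<le> 2"
proof (rule ccontr)
  assume "\<not> N v \<le> 2"
  interpret S: prob_space std_normal_distribution by (rule prob_space_std_normal)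
  let ?P = "PiM {..<1::nat} (\<lambda>_. std_normal_distribution)"
  have scale: "N (c *\<^sub>R x) = \<bar>c\<bar> * N x" for c x using N by (simp add: is_norm_on_def)
  have "gauss_fin 1 (\<lambda>_. v) {w \<in> span {v}. N w > 1/2} < 1/2"
  proof (rule F0)
    show "fin_dim_subspace (span {v})" unfolding fin_dim_subspace_def by auto
    show "\<forall>x\<in>span {v}. \<forall>y\<in>F0. inner x y = 0"
      using v(2) by (auto simp: span_singleton)
    show "orthonormal_basis_of (span {v}) 1 (\<lambda>_. v)"
      unfolding orthonormal_basis_of_def using v(1) by (simp add: dot_square_norm lessThan_Suc)
  qed
  also have "gauss_fin 1 (\<lambda>_. v) {w \<in> span {v}. N w > 1/2}
      = measure ?P ((\<lambda>t. t 0) -` {x. \<bar>x\<bar> * N v > 1/2} \<inter> space ?P)"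
    unfolding gauss_fin_def Let_def
    by (rule arg_cong[where f = "measure ?P"]) (auto simp: scale span_base span_scale)
  also have "\<dots> = measure (distr ?P std_normal_distribution (\<lambda>t. t 0)) {x. \<bar>x\<bar> * N v > 1/2}"
    by (rule measure_distr[symmetric]) auto
  also have "\<dots> = measure std_normal_distribution {x. \<bar>x\<bar> * N v > 1/2}"
    by (subst distr_PiM_component) (auto intro: prob_space_std_normal)
  finally have less: "measure std_normal_distribution {x. \<bar>x\<bar> * N v > 1/2} < 1/2" .
  have "1 - measure std_normal_distribution {x. \<bar>x\<bar> * N v > 1/2}
      = measure std_normal_distribution (UNIV - {x. \<bar>x\<bar> * N v > 1/2})"
    using S.prob_compl[of "{x. \<bar>x\<bar> * N v > 1/2}"] by simp
  also have "\<dots> \<le> measure std_normal_distribution {x. \<bar>x\<bar> \<le> 1/4}"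
  proof (rule S.finite_measure_mono)
    show "UNIV - {x. \<bar>x\<bar> * N v > 1/2} \<subseteq> {x. \<bar>x\<bar> \<le> 1/4}"
    proof
      fix x assume "x \<in> UNIV - {x. \<bar>x\<bar> * N v > 1/2}"
      then have "\<bar>x\<bar> * N v \<le> 1/2" by simp
      moreover have "\<bar>x\<bar> * 2 \<le> \<bar>x\<bar> * N v"
        using \<open>\<not> N v \<le> 2\<close> by (intro mult_left_mono) auto
      ultimately show "x \<in> {x. \<bar>x\<bar> \<le> 1/4}" by simp
    qed
  qed simp
  also have "\<dots> \<le> 2 * (1/4)" by (rule std_normal_small_ball) simp
  finally show False using less by simp
qed

text \<open>Continuity of \<open>N\<close> for the Hilbert norm. Off the exceptional subspace for
  tolerance 1/2 the constant 2 works; on that subspace finitely many Fourier coefficients, each at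
  most \<open>norm h\<close>, control \<open>N\<close>.\<close>

lemma measurable_norm_bounded:
  fixes N :: "'a::real_inner \<Rightarrow> real"
  assumes "measurable_norm N"
  shows "\<exists>C. \<forall>h. N h \<le> C * norm h"
proof -
  have N: "is_norm_on N" using assms by (simp add: measurable_norm_def)
  then have scale: "\<And>c x. N (c *\<^sub>R x) = \<bar>c\<bar> * N x" and zero: "N 0 = 0"
    and nonneg: "\<And>x. 0 \<le> N x" and tri: "\<And>x y. N (x + y) \<le> N x + N y"
    unfolding is_norm_on_def by blast+
  obtain F0 where F0: "fin_dim_subspace F0" and small: "\<And>F1 k e. fin_dim_subspace F1 \<Longrightarrow>
      \<forall>x\<in>F1. \<forall>y\<in>F0. inner x y = 0 \<Longrightarrow> orthonormal_basis_of F1 k e \<Longrightarrow>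
      gauss_fin k e {v\<in>F1. N v > 1/2} < 1/2"
    using assms[unfolded measurable_norm_def, THEN conjunct2, rule_format, of "1/2"] by auto
  obtain S where S: "finite S" "F0 = span S" using F0 by (auto simp: fin_dim_subspace_def)
  obtain k and d :: "nat \<Rightarrow> 'a" where "S = d ` {i. i < k}"
    using finite_imp_nat_seg_image_inj_on[OF S(1)] by auto
  then have F0d: "F0 = span (d ` {..<k})" using S(2) by (simp add: lessThan_def)
  define e where "e = gram_schmidt d"
  have e: "partial_orthonormal e" and F0e: "F0 = span (e ` {..<k})"
    unfolding e_def F0d by (simp_all add: partial_orthonormal_gram_schmidt span_gram_schmidt)
  have N_sum: "N (\<Sum>i<n. g i) \<le> (\<Sum>i<n. N (g i))" for n and g :: "nat \<Rightarrow> 'a"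
    by (induction n) (auto simp: zero intro: order_trans[OF tri])
  have "N h \<le> (2 + (\<Sum>i<k. N (e i))) * norm h" for h
  proof -
    define w where "w = h - fourier_sum e k h"
    have orth: "inner w y = 0" if "y \<in> F0" for y
      unfolding w_def using that F0e by (intro fourier_sum_orthogonal_span[OF e]) auto
    have Nw: "N w \<le> 2 * norm w"
    proof (cases "w = 0")
      case False
      let ?v = "(1 / norm w) *\<^sub>R w"
      have "N ?v \<le> 2"
        by (rule measurable_norm_bound_on_orthogonal[OF N small]) (use False orth in auto)
      then show ?thesis using False by (simp add: scale field_simps)
    qed (simp add: zero)
    have "norm w \<le> norm h"
      using norm_fourier_sum_best[OF e span_zero, of h k] by (simp add: w_def)
    have "N (fourier_sum e k h) \<le> (\<Sum>i<k. N (inner h (e i) *\<^sub>R e i))"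
      unfolding fourier_sum_def by (rule N_sum)
    also have "\<dots> \<le> (\<Sum>i<k. norm h * N (e i))"
    proof (rule sum_mono)
      fix i
      have "\<bar>inner h (e i)\<bar> \<le> norm h * norm (e i)" by (rule Cauchy_Schwarz_ineq2)
      also have "\<dots> \<le> norm h * 1"
        using norm_partial_orthonormal_le_one[OF e] by (intro mult_left_mono) auto
      finally show "N (inner h (e i) *\<^sub>R e i) \<le> norm h * N (e i)"
        unfolding scale using nonneg by (intro mult_right_mono) auto
    qed
    finally have "N (fourier_sum e k h) \<le> norm h * (\<Sum>i<k. N (e i))"
      by (simp add: sum_distrib_left)
    then have "N (w + fourier_sum e k h) \<le> 2 * norm h + norm h * (\<Sum>i<k. N (e i))"
      using tri[of w "fourier_sum e k h"] Nw \<open>norm w \<le> norm h\<close> by linarith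
    then show ?thesis by (simp add: w_def algebra_simps)
  qed
  then show ?thesis by blast
qed

section \<open>Gaussian series in the completion\<close>

text \<open>One family must serve two purposes: it has to expand every projection onto
  \<open>M\<close>, and its first \<open>k n\<close> members have to span the projection of the
  \<open>n\<close>-th exceptional subspace.\<close>

lemma exists_adapted_basis:
  fixes N :: "'h::{real_inner, complete_space} \<Rightarrow> real"
  assumes sep: "countable (D0 :: 'h set)" "closure D0 = UNIV"
    and N: "measurable_norm N" and M: "subspace M" "closed M"
  obtains e :: "nat \<Rightarrow> 'h" and k :: "nat \<Rightarrow> nat"
  where "partial_orthonormal e" "\<And>i. e i \<in> M"
    "\<And>h. (\<lambda>n. fourier_sum e n h) \<longlonglongrightarrow> orth_proj M h" "strict_mono k"
    "\<And>n F l b. fin_dim_subspace F \<Longrightarrow> F \<subseteq> M \<Longrightarrow> \<forall>x\<in>F. \<forall>i<k n. inner x (e i) = 0 \<Longrightarrow>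
      orthonormal_basis_of F l b \<Longrightarrow> gauss_fin l b {v\<in>F. N v > (1/2) ^ n} < (1/2) ^ n"
proof -
  let ?P = "orth_proj M"
  have "\<exists>F0. fin_dim_subspace F0 \<and>
      (\<forall>F1 l b. fin_dim_subspace F1 \<and> (\<forall>x\<in>F1. \<forall>y\<in>F0. inner x y = 0) \<and> orthonormal_basis_of F1 l b \<longrightarrow>
        gauss_fin l b {v\<in>F1. N v > (1/2) ^ n} < (1/2) ^ n)" for n :: nat
    using N[unfolded measurable_norm_def, THEN conjunct2, rule_format, of "(1/2) ^ n"] by simp
  then obtain F0 where F0: "\<And>n. fin_dim_subspace (F0 n)"
    and small: "\<And>n F1 l b. fin_dim_subspace F1 \<Longrightarrow> \<forall>x\<in>F1. \<forall>y\<in>F0 n. inner x y = 0 \<Longrightarrow>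
      orthonormal_basis_of F1 l b \<Longrightarrow> gauss_fin l b {v\<in>F1. N v > (1/2) ^ n} < (1/2) ^ n"
    by metis
  obtain G where G: "\<And>n. finite (G n)" "\<And>n. F0 n = span (G n)"
    using F0 unfolding fin_dim_subspace_def by metis
  \<comment> \<open>A single enumeration contains the dense set and all generators, so each
    exceptional subspace is spanned within an initial segment.\<close>
  define D where "D = D0 \<union> (\<Union>n. G n)"
  have "countable D" unfolding D_def using sep(1) G(1) by (auto intro: countable_finite)
  moreover have "D \<noteq> {}" using sep(2) by (auto simp: D_def)
  ultimately have ran: "range (from_nat_into D) = D" by (rule range_from_nat_into[rotated])
  define d where "d = from_nat_into D"
  have dense: "closure (range d) = UNIV"
    using closure_mono[of D0 D] sep(2) ran by (auto simp: D_def d_def)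
  have "\<exists>K. G n \<subseteq> d ` {..<K}" for n
  proof -
    have "G n \<subseteq> d ` UNIV" using ran by (auto simp: D_def d_def)
    then obtain C where C: "finite C" "G n = d ` C" using finite_subset_image[OF G(1)] by metis
    then obtain K where "\<forall>i\<in>C. i < K" using finite_nat_set_iff_bounded by blast
    with C show ?thesis by auto
  qed
  then obtain K where K: "\<And>n. G n \<subseteq> d ` {..<K n}" by metis
  \<comment> \<open>Summing successors makes \<open>k\<close> strictly increasing while keeping
    \<open>k n \<ge> K n\<close>.\<close>
  define k where "k n = (\<Sum>i\<le>n. Suc (K i))" for n
  define e where "e = gram_schmidt (\<lambda>i. ?P (d i))"
  have span: "span (e ` {..<n}) = span ((\<lambda>i. ?P (d i)) ` {..<n})" for n
    unfolding e_def by (rule span_gram_schmidt)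
  show thesis
  proof (rule that)
    show "partial_orthonormal e" unfolding e_def by (rule partial_orthonormal_gram_schmidt)
    show "e i \<in> M" for i
      unfolding e_def by (intro gram_schmidt_mem M orth_proj_mem)
    show "(\<lambda>n. fourier_sum e n h) \<longlonglongrightarrow> ?P h" for h
      unfolding e_def by (rule fourier_sum_tendsto_orth_proj[OF M dense])
    show "strict_mono k" unfolding k_def by (rule strict_monoI_Suc) simp
    fix n F l b
    assume F: "fin_dim_subspace F" "F \<subseteq> M" "\<forall>x\<in>F. \<forall>i<k n. inner x (e i) = 0"
      and b: "orthonormal_basis_of F l b"
    have "inner x y = 0" if x: "x \<in> F" and y: "y \<in> F0 n" for x y
    proof -
      have "inner x z = 0" if "z \<in> span (e ` {..<k n})" for z
        using that by (induction rule: span_induct_alt) (auto simp: inner_add_right F(3)[rule_format, OF x])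
      then have "inner x (?P (d i)) = 0" if "i < k n" for i
        using that unfolding span by (auto intro: span_base)
      then have xd: "inner x (d i) = 0" if "i < k n" for i
        using inner_orth_proj[OF M, of x "d i"] F(2) x that by (metis inner_commute subsetD)
      have "K n \<le> k n" unfolding k_def by (simp add: sum.atMost_Suc lessThan_Suc_atMost[symmetric])
      then have xG: "inner x z = 0" if "z \<in> G n" for z using K[of n] that xd by fastforce
      show ?thesis
        using y unfolding G(2) by (induction rule: span_induct_alt) (auto simp: inner_add_right xG)
    qed
    then show "gauss_fin l b {v\<in>F. N v > (1/2) ^ n} < (1/2) ^ n"
      by (intro small F b) auto
  qed
qed

section \<open>Independent standard normal coefficients\<close>

abbreviation std_normal_seq :: "(nat \<Rightarrow> real) measure" where
  "std_normal_seq \<equiv> PiM UNIV (\<lambda>_. std_normal_distribution)"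

interpretation std_normal_seq: prob_space std_normal_seq
  by (intro prob_space_PiM prob_space_std_normal)

text \<open>Only the first \<open>n\<close> coordinates matter, so the integral passes to a finite
  product and factors into one-dimensional normal characteristic functions.\<close>

lemma integral_std_normal_seq_cis_sum:
  "(LINT t|std_normal_seq. cis (\<Sum>i<n. t i * a i)) = complex_of_real (exp (- (\<Sum>i<n. (a i)\<^sup>2) / 2))"
proof -
  let ?S = "\<lambda>_::nat. std_normal_distribution"
  interpret S: prob_space std_normal_distribution by (rule prob_space_std_normal)
  interpret product_prob_space ?S UNIV by unfold_locales
  have [measurable]: "(\<lambda>x. cis (x * c)) \<in> borel_measurable std_normal_distribution" for c :: real
    by (simp add: cis_conv_exp)
  have cis_sum: "cis (\<Sum>i<n. t i * a i) = (\<Prod>i<n. cis (t i * a i))" for t :: "nat \<Rightarrow> real"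
    by (induction n) (simp_all add: cis_mult[symmetric])
  have "(LINT t|std_normal_seq. cis (\<Sum>i<n. t i * a i))
      = (LINT t|std_normal_seq. (\<lambda>t. \<Prod>i<n. cis (t i * a i)) (restrict t {..<n}))"
    unfolding cis_sum by (intro Bochner_Integration.integral_cong refl prod.cong) auto
  also have "\<dots> = (LINT t|distr std_normal_seq (PiM {..<n} ?S) (\<lambda>t. restrict t {..<n}).
      (\<Prod>i<n. cis (t i * a i)))"
    by (rule integral_distr[symmetric]) (rule measurable_restrict_subset, simp_all)
  also have "distr std_normal_seq (PiM {..<n} ?S) (\<lambda>t. restrict t {..<n}) = PiM {..<n} ?S"
    by (rule distr_PiM_restrict_finite) auto
  also have "(LINT t|PiM {..<n} ?S. (\<Prod>i<n. cis (t i * a i)))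
      = (\<Prod>i<n. (LINT x|std_normal_distribution. cis (x * a i)))"
    by (rule product_integral_prod) (auto intro!: S.integrable_const_bound[where B = 1])
  also have "\<dots> = (\<Prod>i<n. complex_of_real (exp (- (a i)\<^sup>2 / 2)))"
  proof (rule prod.cong[OF refl])
    show "(LINT x|std_normal_distribution. cis (x * a i)) = complex_of_real (exp (- (a i)\<^sup>2 / 2))" for i
      using fun_cong[OF char_std_normal_distribution, of "a i"]
      by (simp add: char_def cis_conv_exp mult.commute)
  qed
  also have "\<dots> = complex_of_real (exp (- (\<Sum>i<n. (a i)\<^sup>2) / 2))"
    by (simp add: of_real_prod[symmetric] exp_sum[symmetric] sum_negf sum_divide_distrib)
  finally show ?thesis .
qed

lemma borel_measurable_sum_scaleR_separable:
  fixes b :: "'i \<Rightarrow> 'b::real_normed_vector"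
  assumes D: "countable (D :: 'b set)" "closure D = UNIV"
    and X: "\<And>i. i \<in> I \<Longrightarrow> X i \<in> borel_measurable M"
  shows "(\<lambda>t. \<Sum>i\<in>I. X i t *\<^sub>R b i) \<in> borel_measurable M"
proof (rule borel_measurable_if_functionals[OF D])
  fix g :: "'b \<Rightarrow> real" assume "bounded_linear g"
  then have g: "linear g" by (rule bounded_linear.linear)
  show "(\<lambda>t. g (\<Sum>i\<in>I. X i t *\<^sub>R b i)) \<in> borel_measurable M"
    unfolding linear_sum[OF g] linear_scale[OF g] using X by simp
qed

text \<open>Bridges the sequence model and \<open>gauss_fin\<close>, which demands unit vectors
  indexed from 0. Indices with \<open>e i = 0\<close> are dropped without changing the sum or the
  span, and a bijection \<open>s\<close> renumbers the rest.\<close>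

lemma measure_std_normal_seq_block:
  fixes e :: "nat \<Rightarrow> 'h::real_inner" and j :: "'h \<Rightarrow> 'b::real_normed_vector"
  assumes D: "countable (D :: 'b set)" "closure D = UNIV"
    and j: "linear j" "\<And>h. norm (j h) = N h" and e: "partial_orthonormal e" and I: "finite I"
  obtains l b where "orthonormal_basis_of (span (e ` I)) l b"
    "measure std_normal_seq {t \<in> space std_normal_seq. norm (\<Sum>i\<in>I. t i *\<^sub>R j (e i)) > \<epsilon>}
      = gauss_fin l b {v \<in> span (e ` I). N v > \<epsilon>}"
proof -
  define I' where "I' = {i\<in>I. e i \<noteq> 0}"
  have "finite I'" using I by (simp add: I'_def)
  then obtain s where "bij_betw s {0..<card I'} I'" using ex_bij_betw_nat_finite by blast
  then obtain l where s: "bij_betw s {..<l} I'" by (metis atLeast0LessThan)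
  let ?S = "\<lambda>_::nat. std_normal_distribution"
  let ?Q = "PiM {..<l} ?S"
  define \<phi> where "\<phi> = (\<lambda>t::nat \<Rightarrow> real. \<lambda>i\<in>{..<l}. t (s i))"
  have sI: "s ` {..<l} = I'" using s by (simp add: bij_betw_def)
  have span: "span ((e \<circ> s) ` {..<l}) = span (e ` I)"
  proof -
    have "e ` I \<subseteq> insert 0 (e ` I')" by (auto simp: I'_def)
    then have "span (e ` I) \<subseteq> span (e ` I')" using span_mono span_insert_0 by metis
    moreover have "span (e ` I') \<subseteq> span (e ` I)" by (rule span_mono) (auto simp: I'_def)
    ultimately show ?thesis using sI by (simp only: image_comp[symmetric])
  qed
  have sum: "(\<Sum>i\<in>I. t i *\<^sub>R j (e i)) = (\<Sum>i<l. t (s i) *\<^sub>R j (e (s i)))" for t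
  proof -
    have "(\<Sum>i\<in>I. t i *\<^sub>R j (e i)) = (\<Sum>i\<in>I'. t i *\<^sub>R j (e i))"
      by (rule sum.mono_neutral_right) (auto simp: I'_def I linear_0[OF j(1)])
    then show ?thesis using sum.reindex_bij_betw[OF s, of "\<lambda>i. t i *\<^sub>R j (e i)"] by simp
  qed
  have Nj: "N (\<Sum>i<l. t i *\<^sub>R e (s i)) = norm (\<Sum>i<l. t i *\<^sub>R j (e (s i)))" for t
    using j(2)[of "\<Sum>i<l. t i *\<^sub>R e (s i)"] by (simp add: linear_sum[OF j(1)] linear_scale[OF j(1)])
  show thesis
  proof (rule that)
    show "orthonormal_basis_of (span (e ` I)) l (e \<circ> s)"
      unfolding orthonormal_basis_of_def
    proof (intro conjI allI impI span)
      fix a b assume "a < l" "b < l"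
      then have "s a \<in> I'" "s b \<in> I'" "s a = s b \<longleftrightarrow> a = b"
        using sI s by (auto simp: bij_betw_def inj_on_eq_iff)
      moreover from this have "norm (e (s a)) = 1"
        using e by (auto simp: partial_orthonormal_def I'_def)
      ultimately show "inner ((e \<circ> s) a) ((e \<circ> s) b) = (if a = b then 1 else 0)"
        using e by (auto simp: partial_orthonormal_def dot_square_norm)
    qed
    define A where "A = {t \<in> space ?Q. norm (\<Sum>i<l. t i *\<^sub>R j (e (s i))) > \<epsilon>}"
    have [measurable]: "(\<lambda>t. \<Sum>i<l. t i *\<^sub>R j (e (s i))) \<in> borel_measurable ?Q"
      by (rule borel_measurable_sum_scaleR_separable[OF D]) simp
    have [measurable]: "(norm :: 'b \<Rightarrow> real) \<in> borel_measurable borel"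
      by (intro borel_measurable_continuous_onI continuous_intros)
    have nm: "(\<lambda>t. norm (\<Sum>i<l. t i *\<^sub>R j (e (s i)))) \<in> borel_measurable ?Q"
      by (rule measurable_compose[where N = borel]) measurable
    have A: "A \<in> sets ?Q" unfolding A_def using nm by measurable
    have \<phi>: "\<phi> \<in> measurable std_normal_seq ?Q" unfolding \<phi>_def by measurable
    have "gauss_fin l (e \<circ> s) {v \<in> span (e ` I). N v > \<epsilon>} = measure ?Q A"
    proof -
      have "(\<Sum>i<l. t i *\<^sub>R (e \<circ> s) i) \<in> span (e ` I)" for t :: "nat \<Rightarrow> real"
        unfolding span[symmetric] by (intro span_sum span_scale span_base) auto
      then show ?thesis
        unfolding gauss_fin_def Let_def A_def by (simp add: Nj)
    qed
    \<comment> \<open>Selecting distinct coordinates of the infinite product gives a finite product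
      of the same factors.\<close>
    also have "?Q = distr std_normal_seq ?Q \<phi>"
      unfolding \<phi>_def using s
      by (intro distr_PiM_reindex[where K = UNIV, symmetric] prob_space_std_normal) (auto simp: bij_betw_def)
    also have "measure (distr std_normal_seq ?Q \<phi>) A = measure std_normal_seq (\<phi> -` A \<inter> space std_normal_seq)"
      by (rule measure_distr[OF \<phi> A])
    also have "\<phi> -` A \<inter> space std_normal_seq
        = {t \<in> space std_normal_seq. norm (\<Sum>i\<in>I. t i *\<^sub>R j (e i)) > \<epsilon>}"
    proof -
      have "(\<Sum>i<l. \<phi> t i *\<^sub>R j (e (s i))) = (\<Sum>i\<in>I. t i *\<^sub>R j (e i))" for t
        unfolding sum by (rule sum.cong) (auto simp: \<phi>_def)
      then show ?thesis using measurable_space[OF \<phi>] by (auto simp: A_def)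
    qed
    finally show "measure std_normal_seq {t \<in> space std_normal_seq. norm (\<Sum>i\<in>I. t i *\<^sub>R j (e i)) > \<epsilon>}
      = gauss_fin l (e \<circ> s) {v \<in> span (e ` I). N v > \<epsilon>}" ..
  qed
qed

text \<open>The partial sums along the adapted basis converge almost surely in the completion: the
  blocks between consecutive indices are orthogonal to the exceptional subspaces of the measurable
  norm, so their norms are summable by Borel--Cantelli.\<close>

lemma AE_summable_blocks:
  fixes e :: "nat \<Rightarrow> 'h::real_inner" and j :: "'h \<Rightarrow> 'b::real_normed_vector"
  assumes D: "countable (D :: 'b set)" "closure D = UNIV"
    and j: "linear j" "\<And>h. norm (j h) = N h" and e: "partial_orthonormal e"
    and M: "subspace M" "\<And>i. e i \<in> M" and k: "strict_mono k"
    and small: "\<And>n F l b. fin_dim_subspace F \<Longrightarrow> F \<subseteq> M \<Longrightarrow>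
      \<forall>x\<in>F. \<forall>i<k n. inner x (e i) = 0 \<Longrightarrow>
      orthonormal_basis_of F l b \<Longrightarrow> gauss_fin l b {v\<in>F. N v > (1/2) ^ n} < (1/2) ^ n"
  shows "AE t in std_normal_seq. \<forall>\<^sub>F n in sequentially.
    norm (\<Sum>i\<in>{k n..<k (Suc n)}. t i *\<^sub>R j (e i)) \<le> (1/2) ^ n"
proof -
  let ?I = "\<lambda>n. {k n..<k (Suc n)}"
  define B where "B n = {t \<in> space std_normal_seq. norm (\<Sum>i\<in>?I n. t i *\<^sub>R j (e i)) > (1/2) ^ n}" for n
  have "(\<lambda>t. \<Sum>i\<in>?I n. t i *\<^sub>R j (e i)) \<in> borel_measurable std_normal_seq" for n
    by (rule borel_measurable_sum_scaleR_separable[OF D]) simp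
  moreover have "(norm :: 'b \<Rightarrow> real) \<in> borel_measurable borel"
    by (intro borel_measurable_continuous_onI continuous_intros)
  ultimately have [measurable]: "(\<lambda>t. norm (\<Sum>i\<in>?I n. t i *\<^sub>R j (e i))) \<in> borel_measurable std_normal_seq" for n
    by (rule measurable_compose)
  have meas: "B n \<in> sets std_normal_seq" for n unfolding B_def by measurable
  have bound: "measure std_normal_seq (B n) \<le> (1/2) ^ n" for n
  proof -
    obtain l b where b: "orthonormal_basis_of (span (e ` ?I n)) l b"
      and eq: "measure std_normal_seq (B n) = gauss_fin l b {v \<in> span (e ` ?I n). N v > (1/2) ^ n}"
      unfolding B_def
      by (rule measure_std_normal_seq_block[OF D j e, of "?I n" "(1/2) ^ n"]) auto
    have "gauss_fin l b {v \<in> span (e ` ?I n). N v > (1/2) ^ n} < (1/2) ^ n"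
    proof (rule small[OF _ _ _ b])
      show "fin_dim_subspace (span (e ` ?I n))" unfolding fin_dim_subspace_def by auto
      show "span (e ` ?I n) \<subseteq> M" using M by (intro span_minimal) auto
      have "inner x (e i) = 0" if "x \<in> span (e ` ?I n)" "i < k n" for x i
        using that(1) by (induction rule: span_induct_alt)
          (use e that(2) in \<open>auto simp: inner_add_left partial_orthonormal_def\<close>)
      then show "\<forall>x\<in>span (e ` ?I n). \<forall>i<k n. inner x (e i) = 0" by blast
    qed
    with eq show ?thesis by simp
  qed
  have "AE t in std_normal_seq. \<forall>\<^sub>F n in sequentially. t \<in> space std_normal_seq - B n"
  proof (rule borel_cantelli_AE1[OF meas])
    show "summable (\<lambda>n. measure std_normal_seq (B n))"
      by (rule summable_comparison_test'[OF summable_geometric[of "1/2 :: real"]]) (use bound in auto)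
  qed (simp add: std_normal_seq.emeasure_eq_measure)
  then show ?thesis
  proof eventually_elim
    case (elim t)
    then show ?case by (rule eventually_mono) (simp add: B_def not_less)
  qed
qed

lemma convergent_if_blocks_small:
  fixes f :: "nat \<Rightarrow> 'b::banach"
  assumes "strict_mono k" "\<forall>\<^sub>F n in sequentially. norm (\<Sum>i\<in>{k n..<k (Suc n)}. f i) \<le> (1/2) ^ n"
  shows "convergent (\<lambda>n. \<Sum>i<k n. f i)"
proof -
  let ?u = "\<lambda>n. \<Sum>i\<in>{k n..<k (Suc n)}. f i"
  have "summable ?u"
    by (rule summable_comparison_test_ev[OF assms(2)]) (simp add: summable_geometric)
  then have "convergent (\<lambda>n. (\<Sum>i<k 0. f i) + (\<Sum>m<n. ?u m))"
    by (simp add: summable_iff_convergent convergent_add_const_iff)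
  moreover have "(\<Sum>i<k n. f i) = (\<Sum>i<k 0. f i) + (\<Sum>m<n. ?u m)" for n
  proof (induction n)
    case (Suc n)
    have "k n \<le> k (Suc n)" using assms(1) by (simp add: strict_mono_less_eq)
    then have "(\<Sum>i<k (Suc n). f i) = (\<Sum>i<k n. f i) + ?u n"
      by (simp add: lessThan_atLeast0 sum.atLeastLessThan_concat)
    with Suc show ?case by (simp add: add.assoc)
  qed simp
  then have "(\<lambda>n. \<Sum>i<k n. f i) = (\<lambda>n. (\<Sum>i<k 0. f i) + (\<Sum>m<n. ?u m))" by (rule ext)
  ultimately show ?thesis by (simp only:)
qed

lemma exists_gaussian_limit:
  fixes e :: "nat \<Rightarrow> 'h::{real_inner, complete_space}" and j :: "'h \<Rightarrow> 'b::banach"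
  assumes D: "countable (D :: 'b set)" "closure D = UNIV"
    and j: "linear j" "\<And>h. norm (j h) = N h" and e: "partial_orthonormal e"
    and M: "subspace M" "\<And>i. e i \<in> M" and k: "strict_mono k"
    and small: "\<And>n F l b. fin_dim_subspace F \<Longrightarrow> F \<subseteq> M \<Longrightarrow>
      \<forall>x\<in>F. \<forall>i<k n. inner x (e i) = 0 \<Longrightarrow>
      orthonormal_basis_of F l b \<Longrightarrow> gauss_fin l b {v\<in>F. N v > (1/2) ^ n} < (1/2) ^ n"
  obtains X where "\<And>g :: 'b \<Rightarrow> real. bounded_linear g \<Longrightarrow> (\<lambda>t. g (X t)) \<in> borel_measurable std_normal_seq"
    "AE t in std_normal_seq. (\<lambda>n. \<Sum>i<k n. t i *\<^sub>R j (e i)) \<longlonglongrightarrow> X t"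
proof -
  let ?S = "\<lambda>n t. \<Sum>i<k n. t i *\<^sub>R j (e i)"
  let ?u = "\<lambda>n t. norm (\<Sum>i\<in>{k n..<k (Suc n)}. t i *\<^sub>R j (e i))"
  define good where "good t \<longleftrightarrow> (\<forall>\<^sub>F n in sequentially. ?u n t \<le> (1/2) ^ n)" for t
  have AE_good: "AE t in std_normal_seq. good t"
    unfolding good_def by (rule AE_summable_blocks[OF D j e M k small])
  have "(\<lambda>t. \<Sum>i\<in>{k n..<k (Suc n)}. t i *\<^sub>R j (e i)) \<in> borel_measurable std_normal_seq" for n
    by (rule borel_measurable_sum_scaleR_separable[OF D]) simp
  moreover have "(norm :: 'b \<Rightarrow> real) \<in> borel_measurable borel"
    by (intro borel_measurable_continuous_onI continuous_intros)
  ultimately have [measurable]: "?u n \<in> borel_measurable std_normal_seq" for n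
    by (rule measurable_compose)
  have [measurable]: "Measurable.pred std_normal_seq good"
    unfolding good_def eventually_sequentially by measurable
  \<comment> \<open>The approximants are replaced by 0 off the good event, so the limit exists at
    every point and \<open>g (X t)\<close> is a pointwise limit of measurable functions.\<close>
  define X where "X t = lim (\<lambda>n. if good t then ?S n t else 0)" for t
  have lim: "(\<lambda>n. if good t then ?S n t else 0) \<longlonglongrightarrow> X t" for t
  proof -
    have "convergent (\<lambda>n. if good t then ?S n t else 0)"
      using convergent_if_blocks_small[OF k, of "\<lambda>i. t i *\<^sub>R j (e i)"]
      by (cases "good t") (simp_all add: good_def convergent_const)
    then show ?thesis unfolding X_def by (simp add: convergent_LIMSEQ_iff)
  qed
  show thesis
  proof (rule that)
    fix g :: "'b \<Rightarrow> real" assume g: "bounded_linear g"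
    have gS: "g (if good t then ?S n t else 0) = (if good t then \<Sum>i<k n. t i * g (j (e i)) else 0)" for n t
      using bounded_linear.linear[OF g] by (simp add: linear_sum linear_scale linear_0)
    show "(\<lambda>t. g (X t)) \<in> borel_measurable std_normal_seq"
    proof (rule borel_measurable_LIMSEQ_real)
      show "(\<lambda>n. g (if good t then ?S n t else 0)) \<longlonglongrightarrow> g (X t)" for t
        by (rule bounded_linear.tendsto[OF g lim])
      show "(\<lambda>t. g (if good t then ?S n t else 0)) \<in> borel_measurable std_normal_seq" for n
        unfolding gS by measurable
    qed
  next
    show "AE t in std_normal_seq. (\<lambda>n. ?S n t) \<longlonglongrightarrow> X t"
      using AE_good
    proof eventually_elim
      case (elim t)
      then show ?case using lim[of t] by simp
    qed
  qed
qed

section \<open>The Gaussian measure of an affine subspace\<close>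

theorem theorem2p2:
  fixes N :: "'h::{real_inner, complete_space} \<Rightarrow> real"
    and j :: "'h \<Rightarrow> 'b::banach"
    and M0 :: "'h set" and p :: 'h
  assumes "separable_sp TYPE('h)"
    and "measurable_norm N"
    and "is_completion_wrt N j"
    and "subspace M0" and "closed M0"
    and "\<forall>m\<in>M0. inner p m = 0"
  shows "\<exists>\<mu>::'b measure. sets \<mu> = sets borel \<and>
           (\<forall>xs. bounded_linear xs \<longrightarrow>
              integral\<^sup>L \<mu> (\<lambda>x. cis (xs x)) =
              exp (\<i> * complex_of_real (xs (j p))
                   - complex_of_real ((onorm (\<lambda>h. xs (j (orth_proj M0 h))))\<^sup>2 / 2))) \<and>
           (\<forall>\<nu>::'b measure. sets \<nu> = sets borel \<and>
              (\<forall>xs. bounded_linear xs \<longrightarrow>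
                 integral\<^sup>L \<nu> (\<lambda>x. cis (xs x)) =
                 exp (\<i> * complex_of_real (xs (j p))
                      - complex_of_real ((onorm (\<lambda>h. xs (j (orth_proj M0 h))))\<^sup>2 / 2)))
              \<longrightarrow> \<nu> = \<mu>) \<and>
           (AE x in \<mu>. x \<in> closure (j ` ((\<lambda>m. p + m) ` M0)))"
proof -
  let ?\<Phi> = "\<lambda>xs. exp (\<i> * complex_of_real (xs (j p))
    - complex_of_real ((onorm (\<lambda>h. xs (j (orth_proj M0 h))))\<^sup>2 / 2))"
  have j: "linear j" "\<And>h. norm (j h) = N h" "closure (range j) = UNIV"
    using assms(3) by (auto simp: is_completion_wrt_def)
  obtain C where C: "\<And>h. N h \<le> C * norm h" using measurable_norm_bounded[OF assms(2)] by blast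
  have bj: "bounded_linear j"
    by (rule bounded_linear_intro[where K = C])
      (use j C in \<open>simp_all add: linear_add linear_scale mult.commute\<close>)
  obtain D0 :: "'h set" where D0: "countable D0" "closure D0 = UNIV"
    using assms(1) by (auto simp: separable_sp_def)
  have D: "countable (j ` D0)" "closure (j ` D0) = UNIV"
  proof -
    \<comment> \<open>Continuity of \<open>j\<close> brings the whole range of \<open>j\<close>,
      itself dense, into the closure of the countable image.\<close>
    have "j ` closure D0 \<subseteq> closure (j ` D0)"
      by (rule image_closure_subset) (auto simp: closure_subset linear_continuous_on[OF bj])
    then have "closure (range j) \<subseteq> closure (j ` D0)" using D0(2) by (simp add: closure_minimal)
    then show "closure (j ` D0) = UNIV" using j(3) by auto
  qed (use D0 in simp)
  note M = assms(4,5)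
  obtain e k where e: "partial_orthonormal e" "\<And>i. e i \<in> M0"
      "\<And>h. (\<lambda>n. fourier_sum e n h) \<longlonglongrightarrow> orth_proj M0 h" and k: "strict_mono k"
    and small: "\<And>n F l b. fin_dim_subspace F \<Longrightarrow> F \<subseteq> M0 \<Longrightarrow>
      \<forall>x\<in>F. \<forall>i<k n. inner x (e i) = 0 \<Longrightarrow>
      orthonormal_basis_of F l b \<Longrightarrow> gauss_fin l b {v\<in>F. N v > (1/2) ^ n} < (1/2) ^ n"
    using exists_adapted_basis[OF D0 assms(2) M] by blast
  obtain X where X: "\<And>g :: 'b \<Rightarrow> real. bounded_linear g \<Longrightarrow> (\<lambda>t. g (X t)) \<in> borel_measurable std_normal_seq"
    and lim: "AE t in std_normal_seq. (\<lambda>n. \<Sum>i<k n. t i *\<^sub>R j (e i)) \<longlonglongrightarrow> X t"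
    using exists_gaussian_limit[OF D j(1,2) e(1) M(1) e(2) k small] by blast
  have meas: "(\<lambda>t. j p + X t) \<in> borel_measurable std_normal_seq"
  proof (rule borel_measurable_if_functionals[OF D])
    fix g :: "'b \<Rightarrow> real" assume g: "bounded_linear g"
    then show "(\<lambda>t. g (j p + X t)) \<in> borel_measurable std_normal_seq"
      using X[OF g] bounded_linear.linear[OF g] by (simp add: linear_add)
  qed
  define \<mu> where "\<mu> = distr std_normal_seq borel (\<lambda>t. j p + X t)"
  have sets: "sets \<mu> = sets borel" by (simp add: \<mu>_def)
  interpret \<mu>: prob_space \<mu> unfolding \<mu>_def by (rule std_normal_seq.prob_space_distr[OF meas])
  have char: "(LINT x|\<mu>. cis (xs x)) = ?\<Phi> xs" if xs: "bounded_linear xs" for xs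
  proof -
    let ?s = "\<lambda>n. \<Sum>i<n. (xs (j (e i)))\<^sup>2"
    let ?b = "onorm (\<lambda>h. xs (j (orth_proj M0 h)))"
    have xm [measurable]: "xs \<in> borel_measurable borel" by (rule bounded_linear_borel_measurable[OF xs])
    note xl = bounded_linear.linear[OF xs]
    have xS: "xs (\<Sum>i<k n. t i *\<^sub>R j (e i)) = (\<Sum>i<k n. t i * xs (j (e i)))" for n t
      by (simp add: linear_sum[OF xl] linear_scale[OF xl])
    note [measurable] = X[OF xs]
    have "(\<lambda>n. LINT t|std_normal_seq. cis (\<Sum>i<k n. t i * xs (j (e i))))
        \<longlonglongrightarrow> (LINT t|std_normal_seq. cis (xs (X t)))"
    proof (rule integral_dominated_convergence[where w = "\<lambda>_. 1"])
      show "AE t in std_normal_seq. (\<lambda>n. cis (\<Sum>i<k n. t i * xs (j (e i)))) \<longlonglongrightarrow> cis (xs (X t))"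
        using lim
      proof eventually_elim
        case (elim t)
        have "(\<lambda>n. xs (\<Sum>i<k n. t i *\<^sub>R j (e i))) \<longlonglongrightarrow> xs (X t)"
          by (rule bounded_linear.tendsto[OF xs elim])
        then show ?case unfolding xS by (intro tendsto_intros)
      qed
    qed (simp_all add: cis_conv_exp)
    moreover have "(\<lambda>n. LINT t|std_normal_seq. cis (\<Sum>i<k n. t i * xs (j (e i))))
        \<longlonglongrightarrow> complex_of_real (exp (- ?b\<^sup>2 / 2))"
    proof -
      have "?s \<longlonglongrightarrow> ?b\<^sup>2"
        by (rule sum_squares_tendsto_onorm_orth_proj[OF M e bounded_linear_compose[OF xs bj]])
      \<comment> \<open>The almost sure limit is taken along \<open>k\<close>, so the variances are
        read along the same indices.\<close>
      then have "(\<lambda>n. ?s (k n)) \<longlonglongrightarrow> ?b\<^sup>2"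
        using LIMSEQ_subseq_LIMSEQ[OF _ k] by (simp add: comp_def)
      then show ?thesis
        unfolding integral_std_normal_seq_cis_sum by (intro tendsto_intros) auto
    qed
    ultimately have eq: "(LINT t|std_normal_seq. cis (xs (X t))) = complex_of_real (exp (- ?b\<^sup>2 / 2))"
      by (rule LIMSEQ_unique)
    have "(LINT x|\<mu>. cis (xs x)) = (LINT t|std_normal_seq. cis (xs (j p + X t)))"
      unfolding \<mu>_def by (rule integral_distr[OF meas]) (simp add: cis_conv_exp)
    also have "\<dots> = (LINT t|std_normal_seq. cis (xs (j p)) * cis (xs (X t)))"
      by (simp add: linear_add[OF xl] cis_mult)
    also have "\<dots> = cis (xs (j p)) * complex_of_real (exp (- ?b\<^sup>2 / 2))"
      by (simp add: eq)
    also have "\<dots> = ?\<Phi> xs"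
      by (simp add: cis_conv_exp exp_of_real[symmetric] mult_exp_exp)
    finally show ?thesis .
  qed
  have unique: "\<nu> = \<mu>"
    if \<nu>: "sets \<nu> = sets borel" "\<And>xs. bounded_linear xs \<Longrightarrow> (LINT x|\<nu>. cis (xs x)) = ?\<Phi> xs"
    for \<nu> :: "'b measure"
  proof -
    \<comment> \<open>At the zero functional both terms of the exponent vanish.\<close>
    have "(LINT x|\<nu>. cis 0) = 1"
      using \<nu>(2)[OF bounded_linear_zero] by (simp add: onorm_zero)
    then interpret \<nu>: prob_space \<nu> by (rule prob_space_if_char_zero)
    show ?thesis
      by (rule measure_eqI_char_functional[OF D])
        (use \<nu> sets char in \<open>simp_all add: \<nu>.finite_measure_axioms \<mu>.finite_measure_axioms\<close>)
  qed
  have conc: "AE x in \<mu>. x \<in> closure (j ` ((\<lambda>m. p + m) ` M0))"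
  proof -
    have "AE t in std_normal_seq. j p + X t \<in> closure (j ` ((\<lambda>m. p + m) ` M0))"
      using lim
    proof eventually_elim
      case (elim t)
      \<comment> \<open>Each shifted partial sum is the image of \<open>p\<close> plus an element of
        \<open>M0\<close>; a limit of such points lies in the closure.\<close>
      show ?case
      proof (rule closed_sequentially[OF closed_closure])
        show "(\<lambda>n. j p + (\<Sum>i<k n. t i *\<^sub>R j (e i))) \<longlonglongrightarrow> j p + X t"
          by (intro tendsto_intros elim)
        fix n
        have "j p + (\<Sum>i<k n. t i *\<^sub>R j (e i)) = j (p + (\<Sum>i<k n. t i *\<^sub>R e i))"
          by (simp add: linear_add[OF j(1)] linear_sum[OF j(1)] linear_scale[OF j(1)])
        moreover have "(\<Sum>i<k n. t i *\<^sub>R e i) \<in> M0"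
          by (intro subspace_sum subspace_scale M e)
        ultimately show "j p + (\<Sum>i<k n. t i *\<^sub>R j (e i)) \<in> closure (j ` ((\<lambda>m. p + m) ` M0))"
          by (intro subsetD[OF closure_subset]) auto
      qed
    qed
    then show ?thesis unfolding \<mu>_def by (subst AE_distr_iff[OF meas]) simp_all
  qed
  show ?thesis
  proof (intro exI[of _ \<mu>] conjI allI impI)
    show "\<nu> = \<mu>" if "sets \<nu> = sets borel \<and> (\<forall>xs. bounded_linear xs \<longrightarrow> (LINT x|\<nu>. cis (xs x)) = ?\<Phi> xs)"
      for \<nu> :: "'b measure"
      by (rule unique) (use that in blast)+
  qed (fact sets, rule char, assumption, fact conc)
qed

end
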